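(* Let $(a_n)_{n\in\mathbb N}$ be an increasing sequence of positive integers and $0<\beta<1$. Then for Lebesgue-almost all $x\in[0,1]$ the sequence $(a_nx)_{n\in\mathbb N}$ (taken mod $1$) has $\beta$--PPC, i.e. $\lim_{N\to\infty}\frac{1}{N^{2-\beta}}\#\{(i,j):1\leqslant i,j\leqslant N,\ i\neq j,\ \|a_ix-a_jx\|\leqslant s/N^{\beta}\}=2s$ for all $s>0$.
   Context: For $y\in\mathbb R$, $\|y\|$ denotes the distance from $y$ to the nearest integer. *)

theory Defs
  imports "HOL-Analysis.Analysis"
begin

definition dist_nearest_int :: "real \<Rightarrow> real" where
  "dist_nearest_int y = \<bar>y - of_int (round y)\<bar>"

text \<open>Sequences are indexed from 1; the value at index 0 plays no role.
  Reducing the sequence mod 1 does not change the differences modulo the integers,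
  so the definition applies to arbitrary real sequences.\<close>

definition pair_count :: "real \<Rightarrow> (nat \<Rightarrow> real) \<Rightarrow> real \<Rightarrow> nat \<Rightarrow> nat" where
  "pair_count \<beta> u s N =
     card {(i, j). i \<in> {1..N} \<and> j \<in> {1..N} \<and> i \<noteq> j \<and>
                   dist_nearest_int (u i - u j) \<le> s / real N powr \<beta>}"

definition has_PPC :: "real \<Rightarrow> (nat \<Rightarrow> real) \<Rightarrow> bool" where
  "has_PPC \<beta> u \<longleftrightarrow>
     (\<forall>s>0. (\<lambda>N. 1 / real N powr (2 - \<beta>) * real (pair_count \<beta> u s N)) \<longlonglongrightarrow> 2 * s)"

end

theory Submission
  imports Defs "HOL-Computational_Algebra.Primes"
begin

text \<open>
  The pair count at scale \<open>N\<close> is squeezed between sums of the form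
  \<open>\<Sum> P((a\<^sub>i - a\<^sub>j) x)\<close> over \<open>i \<noteq> j\<close>, where \<open>P\<close> is a cosine polynomial with coefficients \<open>c\<^sub>k\<close>
  whose degree is a power of \<open>N\<close> and which approximates the indicator of \<open>\<parallel>y\<parallel> \<le> s / N\<^sup>\<beta>\<close>: the
  Bernstein polynomial, in the variable \<open>sin\<^sup>2 (\<pi> y)\<close>, of a piecewise linear ramp. The variance
  of such a sum is a weighted count of solutions of \<open>k v = l w\<close> with differences \<open>v, w\<close>.
  This multiplicative equation is transported to the circle by a map \<open>\<phi>\<close> that turns products into
  sums and is injective on a long initial segment of the integers, so that the variance equals the
  mean of \<open>|C|\<^sup>2 |D|\<^sup>2\<close> with \<open>C = \<Sum> c\<^sub>k e(\<phi>(k) \<theta>)\<close> and \<open>D = \<Sum> e(\<phi>(v) \<theta>)\<close>. Here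
  \<open>|C|\<^sup>2 \<le> V + V (|C|\<^sup>2 / V)\<^sup>l\<close>, the mean of \<open>|D|\<^sup>2\<close> is at most \<open>2 N\<^sup>3\<close>, and the divisor bound
  controls the mean of \<open>|C|\<close> to the power \<open>2l\<close>. With \<open>V\<close> slightly larger than \<open>N\<close> to the
  power \<open>-\<beta>\<close> the normalised variance is at most a negative power of \<open>N\<close>. Hence the limit holds almost
  everywhere along \<open>N = k\<^sup>m\<close> for a suitable \<open>m\<close>, and monotonicity of the pair count fills the gaps.
\<close>

section \<open>Mean squares of trigonometric sums\<close>

lemma integrable_continuous_unit:
  fixes f :: "real \<Rightarrow> real"
  assumes "continuous_on {0..1} f"
  shows "integrable (lebesgue_on {0..1}) f"
  using continuous_imp_integrable[of 0 1 f] assms by simp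

lemma integral_cos_int:
  fixes m :: int
  shows "(\<integral>x. cos (2 * pi * of_int m * x) \<partial>lebesgue_on {0..1}) = of_bool (m = 0)"
proof (cases "m = 0")
  case True
  then show ?thesis
    by (simp add: measure_restrict_space)
next
  case False
  define w where "w = 2 * pi * of_int m"
  have w: "w \<noteq> 0" using False by (simp add: w_def)
  have "((\<lambda>x. cos (w * x)) has_integral (sin (w * 1) / w - sin (w * 0) / w)) {0..1}"
    using w by (intro fundamental_theorem_of_calculus)
      (auto intro!: derivative_eq_intros simp flip: has_real_derivative_iff_has_vector_derivative)
  moreover have "sin w = 0"
    unfolding w_def using sin_int_2pin[of m] by (simp add: mult_ac)
  ultimately have "integral {0..1} (\<lambda>x. cos (w * x)) = 0"
    by (simp add: integral_unique)
  moreover have "integrable (lebesgue_on {0..1}) (\<lambda>x. cos (w * x))"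
    by (intro integrable_continuous_unit continuous_intros)
  ultimately show ?thesis
    using False by (simp add: lebesgue_integral_eq_integral w_def)
qed

lemma cmod_sum_cis_sq:
  "(cmod (\<Sum>i\<in>I. of_real (z i) * cis (t i)))\<^sup>2 = (\<Sum>i\<in>I. \<Sum>j\<in>I. z i * z j * cos (t i - t j))"
proof -
  have "(cmod (\<Sum>i\<in>I. of_real (z i) * cis (t i)))\<^sup>2
      = (\<Sum>i\<in>I. z i * cos (t i))\<^sup>2 + (\<Sum>i\<in>I. z i * sin (t i))\<^sup>2"
    by (simp add: cmod_power2)
  also have "\<dots> = (\<Sum>i\<in>I. \<Sum>j\<in>I. z i * z j * cos (t i - t j))"
    by (simp add: power2_eq_square sum_product cos_diff algebra_simps flip: sum.distrib)
  finally show ?thesis .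
qed

text \<open>Orthogonality of the characters on the unit interval. The frequencies \<open>l i\<close>
  may repeat, so a mean square becomes a weighted count of coincidences; read from right to left,
  such a count becomes a mean square again.\<close>

lemma mean_square_trig_sum:
  fixes l :: "'i \<Rightarrow> nat"
  assumes "finite I"
  shows "(\<integral>x. (cmod (\<Sum>i\<in>I. of_real (z i) * cis (2 * pi * real (l i) * x)))\<^sup>2 \<partial>lebesgue_on {0..1})
       = (\<Sum>i\<in>I. \<Sum>j\<in>I. z i * z j * of_bool (l i = l j))"
proof -
  have eq: "2 * pi * real (l i) * x - 2 * pi * real (l j) * x
      = 2 * pi * of_int (int (l i) - int (l j)) * x" for i j x
    by (simp add: algebra_simps)
  have int: "integrable (lebesgue_on {0..1}) (\<lambda>x. cos (2 * pi * of_int m * x))" for m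
    by (intro integrable_continuous_unit continuous_intros)
  show ?thesis
    unfolding cmod_sum_cis_sq eq
    by (subst Bochner_Integration.integral_sum)
       (auto intro!: int simp: integral_cos_int Bochner_Integration.integral_sum int simp del: of_int_diff)
qed

section \<open>A multiplicative-to-additive map\<close>

lemma base_expansion_unique:
  fixes B :: nat
  assumes "(\<Sum>p<m. d p * B ^ p) = (\<Sum>p<m. e p * B ^ p)"
    and "\<And>p. p < m \<Longrightarrow> d p < B" and "\<And>p. p < m \<Longrightarrow> e p < B" and "p < m"
  shows "d p = e p"
  using assms
proof (induction m arbitrary: d e p)
  case 0
  then show ?case by simp
next
  case (Suc m)
  have shift: "(\<Sum>p<Suc m. f p * B ^ p) = f 0 + B * (\<Sum>p<m. f (Suc p) * B ^ p)" for f :: "nat \<Rightarrow> nat"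
    by (subst sum.lessThan_Suc_shift) (simp add: sum_distrib_left mult_ac)
  have lt: "d 0 < B" "e 0 < B" using Suc.prems by auto
  have eq: "d 0 + B * (\<Sum>p<m. d (Suc p) * B ^ p) = e 0 + B * (\<Sum>p<m. e (Suc p) * B ^ p)"
    using Suc.prems(1) by (simp only: shift)
  have 0: "d 0 = e 0"
    using arg_cong[OF eq, of "\<lambda>t. t mod B"] lt by simp
  with eq lt have "(\<Sum>p<m. d (Suc p) * B ^ p) = (\<Sum>p<m. e (Suc p) * B ^ p)"
    by auto
  then have "\<And>q. q < m \<Longrightarrow> d (Suc q) = e (Suc q)"
    using Suc.IH[of "\<lambda>q. d (Suc q)" "\<lambda>q. e (Suc q)"] Suc.prems by auto
  with 0 Suc.prems(4) show ?case by (cases p) auto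
qed

text \<open>Prime exponents add under multiplication, hence so does any fixed linear combination of
  them. In integers up to \<open>X\<close> only primes up to \<open>X\<close> occur, with exponents
  below \<open>X + 1\<close>, so reading the exponents as digits loses nothing.\<close>

lemma ex_additive_injection:
  "\<exists>\<phi> :: nat \<Rightarrow> nat. (\<forall>m>0. \<forall>n>0. \<phi> (m * n) = \<phi> m + \<phi> n) \<and> inj_on \<phi> {1..X}"
proof -
  \<comment> \<open>Non-prime positions get the digit 0, since multiplicities are in general
    additive only for primes.\<close>
  define d where "d n p = (if prime p then multiplicity p n else 0)" for n p :: nat
  \<comment> \<open>Write the exponents of the prime factorisation as digits in base \<open>X + 1\<close>.\<close>
  define \<phi> where "\<phi> n = (\<Sum>p<Suc X. d n p * (Suc X) ^ p)" for n
  have "\<phi> (m * n) = \<phi> m + \<phi> n" if "m > 0" "n > 0" for m n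
  proof -
    have "d (m * n) p = d m p + d n p" for p
      using that by (simp add: d_def prime_elem_multiplicity_mult_distrib)
    then show ?thesis
      unfolding \<phi>_def by (simp add: algebra_simps sum.distrib del: sum.lessThan_Suc)
  qed
  moreover have "inj_on \<phi> {1..X}"
  proof (rule inj_onI)
    fix m n assume mn: "m \<in> {1..X}" "n \<in> {1..X}" and eq: "\<phi> m = \<phi> n"
    have lt: "d k p < Suc X" if "k \<in> {1..X}" for k p
    proof (cases "prime p")
      case True
      have "multiplicity p k < 2 ^ multiplicity p k" by simp
      also have "\<dots> \<le> p ^ multiplicity p k"
        using True by (intro power_mono) (auto dest: prime_ge_2_nat)
      also have "\<dots> \<le> k"
        using that by (intro dvd_imp_le multiplicity_dvd) auto
      finally show ?thesis using that True by (simp add: d_def)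
    qed (simp add: d_def)
    have "d m p = d n p" if "p < Suc X" for p
      using base_expansion_unique[OF eq[unfolded \<phi>_def]] lt mn that by blast
    moreover have "multiplicity p k = 0" if "k \<in> {1..X}" "\<not> p < Suc X" for p k
      using that by (intro not_dvd_imp_multiplicity_0) (auto dest!: dvd_imp_le)
    ultimately have "multiplicity p m = multiplicity p n" if "prime p" for p
      using that mn by (metis d_def)
    then show "m = n"
      using multiplicity_eq_nat[of m n] mn by simp
  qed
  ultimately show ?thesis by blast
qed

section \<open>The divisor bound\<close>

lemma card_divisors_prime_power_mult:
  fixes m p :: nat
  assumes "prime p" "m > 0"
  shows "card {d. d dvd p ^ k * m} \<le> (k + 1) * card {d. d dvd m}"
proof -
  have "{d. d dvd p ^ k * m} \<subseteq> (\<lambda>(i, e). p ^ i * e) ` ({..k} \<times> {d. d dvd m})"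
  proof
    fix d assume "d \<in> {d. d dvd p ^ k * m}"
    then obtain b c where bc: "d = b * c" "b dvd p ^ k" "c dvd m"
      using division_decomp[of d "p ^ k" m] by blast
    then obtain i where "i \<le> k" "b = p ^ i"
      using divides_primepow_nat[OF assms(1)] by blast
    with bc show "d \<in> (\<lambda>(i, e). p ^ i * e) ` ({..k} \<times> {d. d dvd m})" by auto
  qed
  then have "card {d. d dvd p ^ k * m} \<le> card ({..k} \<times> {d. d dvd m})"
    using assms by (intro surj_card_le) auto
  then show ?thesis by (simp add: card_cartesian_product)
qed

lemma Suc_le_const_mult_powr:
  assumes "\<eta> > 0"
  shows "\<exists>C\<ge>1. \<forall>k::nat. real (k + 1) \<le> C * 2 powr (\<eta> * real k)"
proof -
  \<comment> \<open>Chosen so that \<open>b\<close> times the linear lower bound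
    \<open>1 + \<eta> k ln 2\<close> of the exponential contains the summand
    \<open>k\<close>.\<close>
  define b where "b = 1 + 1 / (\<eta> * ln 2)"
  have b1: "b \<ge> 1" using assms by (simp add: b_def)
  have "real (k + 1) \<le> b * 2 powr (\<eta> * real k)" for k
  proof -
    have "1 + \<eta> * real k * ln 2 \<le> 2 powr (\<eta> * real k)"
      using exp_ge_add_one_self[of "\<eta> * real k * ln 2"] by (simp add: powr_def)
    then have "b * (1 + \<eta> * real k * ln 2) \<le> b * 2 powr (\<eta> * real k)"
      using b1 by (intro mult_left_mono) auto
    moreover have "b * (1 + \<eta> * real k * ln 2) = b + \<eta> * real k * ln 2 + real k"
      using assms by (simp add: b_def field_simps)
    moreover have "\<eta> * real k * ln 2 \<ge> 0" using assms by simp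
    ultimately show ?thesis using b1 by simp
  qed
  with b1 show ?thesis by blast
qed

text \<open>Strong induction that splits off the full power of one prime. A large prime pays for its
  factor \<open>k + 1\<close> with \<open>real (p ^ k) powr \<eta>\<close>; a small prime costs a
  constant factor \<open>C\<close>, and the number of small primes is bounded.\<close>

lemma divisor_bound:
  fixes \<eta> :: real
  assumes "\<eta> > 0"
  shows "\<exists>C\<ge>1. \<forall>n\<ge>1. real (card {d. d dvd n}) \<le> C * real n powr \<eta>"
proof -
  obtain C where C: "C \<ge> 1" "\<And>k::nat. real (k + 1) \<le> C * 2 powr (\<eta> * real k)"
    using Suc_le_const_mult_powr[OF assms] by blast
  \<comment> \<open>Primes above \<open>Y\<close> satisfy \<open>p powr \<eta> \<ge> 2\<close>, and
    then \<open>k + 1 \<le> 2 ^ k\<close> is absorbed without any constant.\<close>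
  define Y where "Y = nat \<lceil>2 powr (1 / \<eta>)\<rceil>"
  define small where "small n = {p::nat. prime p \<and> p \<le> Y \<and> p dvd n}" for n
  have fin: "finite (small n)" for n by (rule finite_subset[of _ "{..Y}"]) (auto simp: small_def)
  have main: "n \<ge> 1 \<Longrightarrow> real (card {d. d dvd n}) \<le> C ^ card (small n) * real n powr \<eta>" for n
  proof (induction n rule: less_induct)
    case (less n)
    show ?case
    proof (cases "n = 1")
      case True
      then have "small n = {}" by (auto simp: small_def)
      then show ?thesis using True by simp
    next
      case False
      then obtain p where p: "prime p" "p dvd n" using prime_factor_nat by blast
      \<comment> \<open>Removing the full power of \<open>p\<close> takes \<open>p\<close> out of
        the small primes of \<open>m\<close>, so each small prime is charged at most once.\<close>
      obtain k m where km: "n = p ^ k * m" "\<not> p dvd m"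
        using multiplicity_decompose'[of n p] p less.prems by (metis not_prime_unit not_one_le_zero)
      have m0: "m > 0" using km less.prems by (cases m) auto
      have k0: "k > 0" using km p by (cases k) auto
      have p2: "p \<ge> 2" using p prime_ge_2_nat by blast
      have "p ^ k > 1" using k0 p2 by (intro one_less_power) auto
      then have "m < n" using km m0 by simp
      then have IH: "real (card {d. d dvd m}) \<le> C ^ card (small m) * real m powr \<eta>"
        using less.IH m0 by simp
      have sub: "small m \<subseteq> small n" by (auto simp: small_def km)
      have key: "real (k + 1) * C ^ card (small m) \<le> C ^ card (small n) * real (p ^ k) powr \<eta>"
      proof (cases "p \<le> Y")
        case True
        have "insert p (small m) \<subseteq> small n" using sub True p by (auto simp: small_def)
        moreover have "p \<notin> small m" using km by (auto simp: small_def)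
        ultimately have "Suc (card (small m)) \<le> card (small n)"
          by (metis card_insert_disjoint card_mono fin)
        then have c: "C * C ^ card (small m) \<le> C ^ card (small n)"
          using C(1) power_increasing[of "Suc (card (small m))"] by simp
        have "2 powr (\<eta> * real k) \<le> real p powr (\<eta> * real k)"
          using p2 assms by (intro powr_mono2) auto
        also have "\<dots> = real (p ^ k) powr \<eta>"
          using p2 by (simp add: powr_powr powr_realpow[symmetric] mult.commute)
        finally have "C * 2 powr (\<eta> * real k) \<le> C * real (p ^ k) powr \<eta>" using C by simp
        with C(2)[of k] have "real (k + 1) \<le> C * real (p ^ k) powr \<eta>" by linarith
        then have "real (k + 1) * C ^ card (small m) \<le> (C * real (p ^ k) powr \<eta>) * C ^ card (small m)"
          using C by (intro mult_right_mono) auto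
        also have "\<dots> = (C * C ^ card (small m)) * real (p ^ k) powr \<eta>" by simp
        also have "\<dots> \<le> C ^ card (small n) * real (p ^ k) powr \<eta>"
          using c by (intro mult_right_mono) auto
        finally show ?thesis .
      next
        case False
        then have "2 powr (1 / \<eta>) \<le> real p" unfolding Y_def by linarith
        then have "(2 powr (1 / \<eta>)) powr \<eta> \<le> real p powr \<eta>"
          using assms by (intro powr_mono2) auto
        then have "2 \<le> real p powr \<eta>" using assms by (simp add: powr_powr)
        then have "2 ^ k \<le> (real p powr \<eta>) ^ k" by (intro power_mono) auto
        also have "\<dots> = real (p ^ k) powr \<eta>"
          using p2 by (simp add: powr_powr powr_realpow[symmetric] mult.commute)
        finally have "2 ^ k \<le> real (p ^ k) powr \<eta>" .
        moreover have "real (k + 1) \<le> 2 ^ k"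
          using less_exp[of k] by (metis Suc_eq_plus1 Suc_leI of_nat_le_iff of_nat_numeral of_nat_power)
        ultimately have "real (k + 1) \<le> real (p ^ k) powr \<eta>" by linarith
        moreover have "C ^ card (small m) \<le> C ^ card (small n)"
          using C card_mono[OF fin sub] by (intro power_increasing) auto
        ultimately show ?thesis
          using C by (subst mult.commute) (intro mult_mono, auto)
      qed
      have "real (card {d. d dvd n}) \<le> real (k + 1) * real (card {d. d dvd m})"
        using card_divisors_prime_power_mult[OF p(1) m0, of k] km
        by (metis of_nat_le_iff of_nat_mult)
      also have "\<dots> \<le> real (k + 1) * (C ^ card (small m) * real m powr \<eta>)"
        using IH by (intro mult_left_mono) auto
      also have "\<dots> \<le> (C ^ card (small n) * real (p ^ k) powr \<eta>) * real m powr \<eta>"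
        using key by (simp only: mult.assoc[symmetric]) (intro mult_right_mono, auto)
      also have "\<dots> = C ^ card (small n) * real n powr \<eta>"
        using km by (simp add: powr_mult)
      finally show ?thesis .
    qed
  qed
  have "real (card {d. d dvd n}) \<le> C ^ Suc Y * real n powr \<eta>" if "n \<ge> 1" for n
  proof -
    have "card (small n) \<le> card {..Y}" by (intro card_mono) (auto simp: small_def)
    then have "C ^ card (small n) \<le> C ^ Suc Y" using C by (intro power_increasing) auto
    then have "C ^ card (small n) * real n powr \<eta> \<le> C ^ Suc Y * real n powr \<eta>"
      by (intro mult_right_mono) auto
    with main[OF that] show ?thesis by linarith
  qed
  moreover have "C ^ Suc Y \<ge> 1" using C by (intro one_le_power)
  ultimately show ?thesis by blast
qed

section \<open>Variance of dilated cosine sums\<close>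

text \<open>The power expands over products \<open>n = k * m\<close>, which \<open>\<phi>\<close>
  turns into single frequencies. The coefficient at \<open>n\<close> is a sum over factorisations of
  \<open>n\<close>, at most \<open>H\<close> in number, so Cauchy-Schwarz costs one factor
  \<open>H\<close> per multiplication.\<close>

lemma dirichlet_polynomial_power:
  fixes c :: "nat \<Rightarrow> real" and \<phi> :: "nat \<Rightarrow> nat"
  assumes add: "\<And>m n. m > 0 \<Longrightarrow> n > 0 \<Longrightarrow> \<phi> (m * n) = \<phi> m + \<phi> n"
    and H: "\<And>n. n \<in> {1..K ^ l} \<Longrightarrow> real (card {d. d dvd n}) \<le> H"
    and K: "K \<ge> 1"
  shows "\<exists>f. (\<forall>x. (\<Sum>k\<in>{1..K}. of_real (c k) * cis (2 * pi * real (\<phi> k) * x)) ^ l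
                = (\<Sum>n\<in>{1..K ^ l}. of_real (f n) * cis (2 * pi * real (\<phi> n) * x)))
           \<and> (\<Sum>n\<in>{1..K ^ l}. (f n)\<^sup>2) \<le> (H * (\<Sum>k\<in>{1..K}. (c k)\<^sup>2)) ^ l"
  using H
proof (induction l)
  case 0
  have "\<phi> 1 = 0" using add[of 1 1] by simp
  then show ?case by (intro exI[of _ "\<lambda>_. 1"]) simp
next
  case (Suc l)
  define e where "e n x = cis (2 * pi * real (\<phi> n) * x)" for n x
  define S where "S = (\<Sum>k\<in>{1..K}. (c k)\<^sup>2)"
  have Kl: "K ^ l \<le> K ^ Suc l" using K by simp
  have "real (card {d. d dvd n}) \<le> H" if "n \<in> {1..K ^ l}" for n
  proof (rule Suc.prems)
    have "n \<ge> 1" "n \<le> K ^ l" using that by auto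
    with Kl show "n \<in> {1..K ^ Suc l}" unfolding atLeastAtMost_iff by linarith
  qed
  then have "\<exists>f. (\<forall>x. (\<Sum>k\<in>{1..K}. of_real (c k) * e k x) ^ l
                = (\<Sum>n\<in>{1..K ^ l}. of_real (f n) * e n x))
           \<and> (\<Sum>n\<in>{1..K ^ l}. (f n)\<^sup>2) \<le> (H * S) ^ l"
    unfolding e_def S_def by (rule Suc.IH)
  then obtain f where f: "\<And>x. (\<Sum>k\<in>{1..K}. of_real (c k) * e k x) ^ l
                = (\<Sum>n\<in>{1..K ^ l}. of_real (f n) * e n x)"
      and f2: "(\<Sum>n\<in>{1..K ^ l}. (f n)\<^sup>2) \<le> (H * S) ^ l" by blast
  define A where "A = {1..K} \<times> {1..K ^ l}"
  define T where "T = {1..K ^ Suc l}"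
  define F where "F n = {p \<in> A. fst p * snd p = n}" for n
  \<comment> \<open>The multiplicative convolution of \<open>c\<close> and \<open>f\<close>, summed
    over the fibre \<open>F n\<close> of the product map.\<close>
  define g where "g n = (\<Sum>p\<in>F n. c (fst p) * f (snd p))" for n
  have fin: "finite A" "finite T" by (auto simp: A_def T_def)
  have img: "(\<lambda>p. fst p * snd p) ` A \<subseteq> T"
  proof clarify
    fix k m assume "(k, m) \<in> A"
    then have "1 \<le> k" "k \<le> K" "1 \<le> m" "m \<le> K ^ l" by (auto simp: A_def)
    then have "1 * 1 \<le> k * m" "k * m \<le> K * K ^ l" by (auto intro: mult_le_mono)
    then show "fst (k, m) * snd (k, m) \<in> T" by (simp add: T_def)
  qed
  have ee: "e (k * m) x = e k x * e m x" if "(k, m) \<in> A" for k m x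
    using that by (simp add: A_def e_def add cis_mult algebra_simps)
  have 1: "(\<Sum>k\<in>{1..K}. of_real (c k) * e k x) ^ Suc l = (\<Sum>n\<in>T. of_real (g n) * e n x)" for x
  proof -
    have "(\<Sum>k\<in>{1..K}. of_real (c k) * e k x) ^ Suc l
        = (\<Sum>p\<in>A. of_real (c (fst p) * f (snd p)) * e (fst p * snd p) x)"
      unfolding power_Suc f sum_product A_def sum.cartesian_product
      by (rule sum.cong) (auto simp: ee[unfolded A_def] mult_ac)
    also have "\<dots> = (\<Sum>n\<in>T. \<Sum>p\<in>F n. of_real (c (fst p) * f (snd p)) * e (fst p * snd p) x)"
      unfolding F_def by (rule sum.group[OF fin img, symmetric])
    also have "\<dots> = (\<Sum>n\<in>T. of_real (g n) * e n x)"
      unfolding g_def of_real_sum sum_distrib_right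
      by (intro sum.cong refl) (auto simp: F_def)
    finally show ?thesis .
  qed
  have H0: "H \<ge> 0" using Suc.prems[of 1] K by simp
  have "(g n)\<^sup>2 \<le> H * (\<Sum>p\<in>F n. (c (fst p) * f (snd p))\<^sup>2)" if "n \<in> T" for n
  proof -
    have n: "n > 0" using that by (simp add: T_def)
    \<comment> \<open>A factorisation of \<open>n > 0\<close> is determined by its first factor, so
      the fibre is no larger than the set of divisors.\<close>
    have "inj_on fst (F n)"
      using n by (auto simp: inj_on_def F_def)
    moreover have "fst ` F n \<subseteq> {d. d dvd n}" by (auto simp: F_def)
    ultimately have "card (F n) \<le> card {d. d dvd n}"
      using n by (intro card_inj_on_le[of fst]) auto
    then have "real (card (F n)) \<le> H" using Suc.prems[of n] that by (simp add: T_def)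
    then have "(\<Sum>p\<in>F n. (c (fst p) * f (snd p))\<^sup>2) * real (card (F n))
        \<le> (\<Sum>p\<in>F n. (c (fst p) * f (snd p))\<^sup>2) * H"
      by (intro mult_left_mono sum_nonneg) auto
    then show ?thesis
      unfolding g_def using sum_squared_le_sum_of_squares[of "\<lambda>p. c (fst p) * f (snd p)" "F n"]
      by (simp add: mult.commute)
  qed
  then have "(\<Sum>n\<in>T. (g n)\<^sup>2) \<le> (\<Sum>n\<in>T. H * (\<Sum>p\<in>F n. (c (fst p) * f (snd p))\<^sup>2))"
    by (rule sum_mono)
  also have "\<dots> = H * (\<Sum>p\<in>A. (c (fst p) * f (snd p))\<^sup>2)"
    unfolding sum_distrib_left[symmetric] F_def sum.group[OF fin img] ..
  also have "(\<Sum>p\<in>A. (c (fst p) * f (snd p))\<^sup>2) = S * (\<Sum>n\<in>{1..K ^ l}. (f n)\<^sup>2)"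
    unfolding S_def A_def sum_product sum.cartesian_product
    by (rule sum.cong) (auto simp: power_mult_distrib)
  also have "H * (S * (\<Sum>n\<in>{1..K ^ l}. (f n)\<^sup>2)) \<le> H * (S * (H * S) ^ l)"
    using f2 H0 by (intro mult_left_mono) (auto simp: S_def intro: sum_nonneg)
  finally have 2: "(\<Sum>n\<in>T. (g n)\<^sup>2) \<le> (H * S) ^ Suc l" by (simp add: mult.assoc)
  show ?case
    using 1 2 unfolding e_def S_def T_def by blast
qed

text \<open>The two terms come from \<open>t \<le> 1 + t ^ l\<close> with
  \<open>t = |C|^2 / V\<close>: the 1 leaves the mean of \<open>|D|^2\<close>, a count of equal
  \<open>v i\<close>, while \<open>t ^ l\<close> is paired with the trivial bound
  \<open>|D| \<le> card I\<close> and the mean square of \<open>C ^ l\<close>. The parameters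
  \<open>V\<close> and \<open>l\<close> stay free to balance both.\<close>

lemma dilated_cosine_sum_variance:
  fixes c :: "nat \<Rightarrow> real" and v :: "'i \<Rightarrow> nat"
  assumes I: "finite I" and v: "\<And>i. i \<in> I \<Longrightarrow> v i > 0"
    and H: "\<And>n. n \<in> {1..K ^ l} \<Longrightarrow> real (card {d. d dvd n}) \<le> H"
    and K: "K \<ge> 1" and l: "l \<ge> 1" and V: "V > 0"
  shows "(\<integral>x. (\<Sum>i\<in>I. \<Sum>k\<in>{1..K}. c k * cos (2 * pi * real k * (real (v i) * x)))\<^sup>2 \<partial>lebesgue_on {0..1})
     \<le> V * real (card {(i, j). i \<in> I \<and> j \<in> I \<and> v i = v j})
       + V * (H * (\<Sum>k\<in>{1..K}. (c k)\<^sup>2) / V) ^ l * (real (card I))\<^sup>2"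
proof -
  define J where "J = I \<times> {1..K}"
  have J: "finite J" using I by (simp add: J_def)
  define M where "M = Max (insert 0 (v ` I))"
  have M: "v i \<le> M" if "i \<in> I" for i unfolding M_def using that I by (intro Max_ge) auto
  \<comment> \<open>Large enough for both uses of injectivity: on the products
    \<open>k * v i\<close> and on the arguments up to \<open>K ^ l\<close> in the expansion of
    \<open>C ^ l\<close>.\<close>
  define X where "X = max (K * M) (K ^ l)"
  obtain \<phi> :: "nat \<Rightarrow> nat" where add: "\<And>m n. m > 0 \<Longrightarrow> n > 0 \<Longrightarrow> \<phi> (m * n) = \<phi> m + \<phi> n"
    and inj: "inj_on \<phi> {1..X}"
    using ex_additive_injection[of X] by blast
  let ?L = "lebesgue_on {0..1::real}"
  define C where "C x = (\<Sum>k\<in>{1..K}. of_real (c k) * cis (2 * pi * real (\<phi> k) * x))" for x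
  define D where "D x = (\<Sum>i\<in>I. of_real 1 * cis (2 * pi * real (\<phi> (v i)) * x))" for x
  define S where "S = (\<Sum>k\<in>{1..K}. (c k)\<^sup>2)"
  have contC: "continuous_on A C" and contD: "continuous_on A D" for A
    unfolding C_def D_def by (intro continuous_intros)+
  \<comment> \<open>The cosine sum is the real part of an exponential sum, and passing to the
    modulus only enlarges the square.\<close>
  have "(\<integral>x. (\<Sum>i\<in>I. \<Sum>k\<in>{1..K}. c k * cos (2 * pi * real k * (real (v i) * x)))\<^sup>2 \<partial>?L)
      \<le> (\<integral>x. (cmod (\<Sum>p\<in>J. of_real (c (snd p)) * cis (2 * pi * real (snd p * v (fst p)) * x)))\<^sup>2 \<partial>?L)"
  proof (rule integral_mono)
    fix x
    have "(\<Sum>i\<in>I. \<Sum>k\<in>{1..K}. c k * cos (2 * pi * real k * (real (v i) * x)))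
      = Re (\<Sum>p\<in>J. of_real (c (snd p)) * cis (2 * pi * real (snd p * v (fst p)) * x))"
      by (simp add: J_def sum.cartesian_product split_def mult_ac)
    then show "(\<Sum>i\<in>I. \<Sum>k\<in>{1..K}. c k * cos (2 * pi * real k * (real (v i) * x)))\<^sup>2
        \<le> (cmod (\<Sum>p\<in>J. of_real (c (snd p)) * cis (2 * pi * real (snd p * v (fst p)) * x)))\<^sup>2"
      by (simp only: cmod_power2) simp
  qed (intro integrable_continuous_unit continuous_intros)+
  also have "\<dots> = (\<Sum>p\<in>J. \<Sum>q\<in>J. c (snd p) * c (snd q) * of_bool (snd p * v (fst p) = snd q * v (fst q)))"
    by (rule mean_square_trig_sum[OF J])
  \<comment> \<open>The products lie where \<open>\<phi>\<close> is injective, so their equality can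
    be tested on images. Orthogonality then reads the count as the mean square of a sum with
    frequencies \<open>\<phi> (k * v i)\<close>, which factors because \<open>\<phi>\<close> is
    additive.\<close>
  also have "\<dots> = (\<Sum>p\<in>J. \<Sum>q\<in>J. c (snd p) * c (snd q) * of_bool (\<phi> (snd p * v (fst p)) = \<phi> (snd q * v (fst q))))"
  proof -
    have "snd p * v (fst p) \<in> {1..X}" if "p \<in> J" for p
    proof -
      have "snd p * v (fst p) \<le> K * M" "1 * 1 \<le> snd p * v (fst p)"
        using that M v by (intro mult_le_mono; auto simp: J_def Suc_le_eq)+
      then show ?thesis by (auto simp: X_def)
    qed
    then show ?thesis
      by (intro sum.cong refl) (auto simp: inj_on_eq_iff[OF inj])
  qed
  also have "\<dots> = (\<integral>x. (cmod (\<Sum>p\<in>J. of_real (c (snd p)) * cis (2 * pi * real (\<phi> (snd p * v (fst p))) * x)))\<^sup>2 \<partial>?L)"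
    by (rule mean_square_trig_sum[OF J, symmetric])
  also have "\<dots> = (\<integral>x. (cmod (C x))\<^sup>2 * (cmod (D x))\<^sup>2 \<partial>?L)"
  proof (rule Bochner_Integration.integral_cong[OF refl])
    fix x
    have "(\<Sum>p\<in>J. of_real (c (snd p)) * cis (2 * pi * real (\<phi> (snd p * v (fst p))) * x)) = D x * C x"
      unfolding C_def D_def J_def sum_product sum.cartesian_product split_def
    proof (rule sum.cong[OF refl])
      fix p assume p: "p \<in> I \<times> {1..K}"
      then have "\<phi> (snd p * v (fst p)) = \<phi> (snd p) + \<phi> (v (fst p))"
        using v by (intro add) auto
      then show "of_real (c (snd p)) * cis (2 * pi * real (\<phi> (snd p * v (fst p))) * x) =
         of_real 1 * cis (2 * pi * real (\<phi> (v (fst p))) * x) *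
         (of_real (c (snd p)) * cis (2 * pi * real (\<phi> (snd p)) * x))"
        by (simp add: cis_mult algebra_simps)
    qed
    then show "(cmod (\<Sum>p\<in>J. of_real (c (snd p)) * cis (2 * pi * real (\<phi> (snd p * v (fst p))) * x)))\<^sup>2
        = (cmod (C x))\<^sup>2 * (cmod (D x))\<^sup>2"
      by (simp add: norm_mult power_mult_distrib)
  qed
  also have "\<dots> \<le> (\<integral>x. V * (cmod (D x))\<^sup>2 + V * (1 / V) ^ l * (real (card I))\<^sup>2 * (cmod (C x ^ l))\<^sup>2 \<partial>?L)"
  proof (rule integral_mono)
    fix x
    define t where "t = (cmod (C x))\<^sup>2 / V"
    have t0: "t \<ge> 0" using V by (simp add: t_def)
    have tl: "t \<le> 1 + t ^ l"
    proof (cases "t \<le> 1")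
      case False
      then have "t ^ 1 \<le> t ^ l" using l by (intro power_increasing) auto
      then show ?thesis by simp
    qed (use t0 in \<open>simp add: add_increasing2\<close>)
    have D: "(cmod (D x))\<^sup>2 \<le> (real (card I))\<^sup>2"
    proof (intro power_mono)
      have "cmod (D x) \<le> (\<Sum>i\<in>I. cmod (of_real 1 * cis (2 * pi * real (\<phi> (v i)) * x)))"
        unfolding D_def by (rule norm_sum)
      then show "cmod (D x) \<le> real (card I)" by simp
    qed auto
    have "(cmod (C x))\<^sup>2 * (cmod (D x))\<^sup>2 = V * (t * (cmod (D x))\<^sup>2)"
      using V by (simp add: t_def)
    also have "t * (cmod (D x))\<^sup>2 \<le> (1 + t ^ l) * (cmod (D x))\<^sup>2"
      using tl by (intro mult_right_mono) auto
    also have "(1 + t ^ l) * (cmod (D x))\<^sup>2 \<le> (cmod (D x))\<^sup>2 + t ^ l * (real (card I))\<^sup>2"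
      using D t0 by (simp add: algebra_simps mult_left_mono)
    finally have "(cmod (C x))\<^sup>2 * (cmod (D x))\<^sup>2 \<le> V * ((cmod (D x))\<^sup>2 + t ^ l * (real (card I))\<^sup>2)"
      using V by simp
    moreover have "t ^ l = (1 / V) ^ l * (cmod (C x ^ l))\<^sup>2"
      by (simp add: t_def power_divide norm_power power_mult[symmetric] mult.commute)
    ultimately show "(cmod (C x))\<^sup>2 * (cmod (D x))\<^sup>2
        \<le> V * (cmod (D x))\<^sup>2 + V * (1 / V) ^ l * (real (card I))\<^sup>2 * (cmod (C x ^ l))\<^sup>2"
      by (simp add: algebra_simps)
  qed (intro integrable_continuous_unit continuous_intros contC contD)+
  also have "\<dots> = V * (\<integral>x. (cmod (D x))\<^sup>2 \<partial>?L)
      + V * (1 / V) ^ l * (real (card I))\<^sup>2 * (\<integral>x. (cmod (C x ^ l))\<^sup>2 \<partial>?L)"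
    by (subst Bochner_Integration.integral_add)
       (auto intro!: integrable_continuous_unit continuous_intros contC contD)
  also have "(\<integral>x. (cmod (D x))\<^sup>2 \<partial>?L) = real (card {(i, j). i \<in> I \<and> j \<in> I \<and> v i = v j})"
  proof -
    have "(\<integral>x. (cmod (D x))\<^sup>2 \<partial>?L) = (\<Sum>i\<in>I. \<Sum>j\<in>I. 1 * 1 * of_bool (\<phi> (v i) = \<phi> (v j)))"
      unfolding D_def by (rule mean_square_trig_sum[OF I])
    also have "\<dots> = (\<Sum>i\<in>I. \<Sum>j\<in>I. of_bool (v i = v j))"
    proof (intro sum.cong refl)
      fix i j assume ij: "i \<in> I" "j \<in> I"
      have "v k \<in> {1..X}" if "k \<in> I" for k
      proof -
        have "1 * v k \<le> K * M" using that M K by (intro mult_le_mono) auto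
        then show ?thesis using v[OF that] by (auto simp: X_def)
      qed
      then show "1 * 1 * of_bool (\<phi> (v i) = \<phi> (v j)) = (of_bool (v i = v j) :: real)"
        using ij by (auto simp: inj_on_eq_iff[OF inj])
    qed
    also have "\<dots> = (\<Sum>p\<in>I \<times> I. of_bool (v (fst p) = v (snd p)))"
      by (simp add: sum.cartesian_product split_def)
    also have "\<dots> = real (card ((I \<times> I) \<inter> {p. v (fst p) = v (snd p)}))"
      using I by (subst sum_of_bool_eq) auto
    also have "(I \<times> I) \<inter> {p. v (fst p) = v (snd p)} = {(i, j). i \<in> I \<and> j \<in> I \<and> v i = v j}"
      by auto
    finally show ?thesis .
  qed
  also have "V * (1 / V) ^ l * (real (card I))\<^sup>2 * (\<integral>x. (cmod (C x ^ l))\<^sup>2 \<partial>?L)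
      \<le> V * (1 / V) ^ l * (real (card I))\<^sup>2 * (H * S) ^ l"
  proof (rule mult_left_mono)
    obtain f where f: "\<And>x. C x ^ l = (\<Sum>n\<in>{1..K ^ l}. of_real (f n) * cis (2 * pi * real (\<phi> n) * x))"
      and f2: "(\<Sum>n\<in>{1..K ^ l}. (f n)\<^sup>2) \<le> (H * S) ^ l"
      using dirichlet_polynomial_power[where \<phi> = \<phi> and K = K and l = l and H = H and c = c, OF add H K]
      unfolding C_def S_def by blast
    have "(\<integral>x. (cmod (C x ^ l))\<^sup>2 \<partial>?L)
        = (\<Sum>m\<in>{1..K ^ l}. \<Sum>n\<in>{1..K ^ l}. f m * f n * of_bool (\<phi> m = \<phi> n))"
      unfolding f by (rule mean_square_trig_sum) simp
    also have "\<dots> = (\<Sum>m\<in>{1..K ^ l}. \<Sum>n\<in>{1..K ^ l}. if m = n then (f m)\<^sup>2 else 0)"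
      by (intro sum.cong refl) (auto simp: inj_on_eq_iff[OF inj] X_def power2_eq_square)
    also have "\<dots> = (\<Sum>n\<in>{1..K ^ l}. (f n)\<^sup>2)" by simp
    finally show "(\<integral>x. (cmod (C x ^ l))\<^sup>2 \<partial>?L) \<le> (H * S) ^ l" using f2 by simp
  qed (use V in auto)
  finally show ?thesis
    by (simp add: S_def power_divide mult_ac)
qed

section \<open>Cosine polynomials approximating an indicator\<close>

text \<open>Under the binomial weights \<open>k / n\<close> has mean \<open>u\<close> and variance
  \<open>u (1 - u) / n\<close>, so its mean distance from \<open>u\<close> is at most
  \<open>1 / sqrt n\<close>. A square degree makes this \<open>1 / m\<close>.\<close>

lemma Bernstein_abs_error_le:
  fixes h :: "real \<Rightarrow> real"
  assumes m: "m > 0" and u: "0 \<le> u" "u \<le> 1"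
    and lip: "\<And>s t. \<bar>h s - h t\<bar> \<le> L * \<bar>s - t\<bar>" and L: "L \<ge> 0"
  shows "\<bar>h u - (\<Sum>k\<le>m\<^sup>2. h (real k / real (m\<^sup>2)) * Bernstein (m\<^sup>2) k u)\<bar> \<le> L / real m"
proof -
  define n where "n = m\<^sup>2"
  have n: "n > 0" "real n = (real m)\<^sup>2" using m by (auto simp: n_def)
  have var: "(\<Sum>k\<le>n. (u - real k / real n)\<^sup>2 * Bernstein n k u) = u * (1 - u) / real n"
  proof -
    \<comment> \<open>Expressed through \<open>k\<close> and \<open>k (k - 1)\<close>, whose sums
      against the Bernstein weights are known.\<close>
    have "(u - real k / real n)\<^sup>2 = u\<^sup>2 - (2 * u / real n - 1 / (real n)\<^sup>2) * real k
          + (1 / (real n)\<^sup>2) * (real k * (real k - 1))" for k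
      using n(1) by (simp add: field_simps power2_eq_square)
    then have "(\<Sum>k\<le>n. (u - real k / real n)\<^sup>2 * Bernstein n k u)
        = (\<Sum>k\<le>n. u\<^sup>2 * Bernstein n k u - (2 * u / real n - 1 / (real n)\<^sup>2) * (real k * Bernstein n k u)
          + (1 / (real n)\<^sup>2) * (real k * (real k - 1) * Bernstein n k u))"
      by (simp only: distrib_right left_diff_distrib mult.assoc)
    also have "\<dots> = u\<^sup>2 - (2 * u / real n - 1 / (real n)\<^sup>2) * (real n * u)
        + (1 / (real n)\<^sup>2) * (real n * (real n - 1) * u\<^sup>2)"
      by (simp only: sum.distrib sum_subtractf sum_distrib_left[symmetric]
          sum_Bernstein sum_k_Bernstein sum_kk_Bernstein mult_1_right)
    also have "\<dots> = u * (1 - u) / real n"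
      using n(1) by (simp add: field_simps power2_eq_square)
    finally show ?thesis .
  qed
  have B0: "Bernstein n k u \<ge> 0" for k using u by (rule Bernstein_nonneg)
  have "u * (1 - u) \<le> 1 * 1" using u by (intro mult_mono) auto
  then have uu: "u * (1 - u) \<le> 1" by simp
  have pt: "\<bar>h u - h (real k / real n)\<bar> \<le> L * (1 / real m + real m * (u - real k / real n)\<^sup>2) / 2" for k
  proof -
    define t where "t = \<bar>u - real k / real n\<bar>"
    \<comment> \<open>AM-GM in the form \<open>2 t \<le> 1 / m + m t^2\<close>, balanced at the
      typical size \<open>t = 1 / m\<close>; it bounds the mean distance by the variance without a
      square root.\<close>
    have "0 \<le> (real m * t - 1)\<^sup>2" by simp
    then have "2 * (real m * t) \<le> 1 + (real m * t)\<^sup>2" by (simp add: power2_eq_square algebra_simps)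
    then have "(2 * (real m * t)) / real m \<le> (1 + (real m * t)\<^sup>2) / real m"
      by (intro divide_right_mono) auto
    then have "2 * t \<le> 1 / real m + real m * t\<^sup>2"
      using m by (simp add: field_simps power2_eq_square)
    then have "t \<le> (1 / real m + real m * (u - real k / real n)\<^sup>2) / 2" by (simp add: t_def)
    then have "L * t \<le> L * ((1 / real m + real m * (u - real k / real n)\<^sup>2) / 2)"
      using L by (intro mult_left_mono) auto
    with lip[of u "real k / real n"] show ?thesis by (simp add: t_def)
  qed
  have "\<bar>h u - (\<Sum>k\<le>n. h (real k / real n) * Bernstein n k u)\<bar>
      = \<bar>\<Sum>k\<le>n. (h u - h (real k / real n)) * Bernstein n k u\<bar>"
    by (simp add: left_diff_distrib sum_subtractf sum_distrib_left[symmetric])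
  also have "\<dots> \<le> (\<Sum>k\<le>n. \<bar>(h u - h (real k / real n)) * Bernstein n k u\<bar>)"
    by (rule sum_abs)
  also have "\<dots> \<le> (\<Sum>k\<le>n. (L * (1 / real m + real m * (u - real k / real n)\<^sup>2) / 2) * Bernstein n k u)"
    unfolding abs_mult abs_of_nonneg[OF B0] using pt B0 by (intro sum_mono mult_right_mono) auto
  also have "\<dots> = (\<Sum>k\<le>n. (L / (2 * real m)) * Bernstein n k u
      + (L * real m / 2) * ((u - real k / real n)\<^sup>2 * Bernstein n k u))"
    by (intro sum.cong refl) (simp add: field_simps)
  also have "\<dots> = L / (2 * real m) + (L * real m / 2) * (u * (1 - u) / real n)"
    by (simp only: sum.distrib sum_distrib_left[symmetric] var sum_Bernstein mult_1_right)
  also have "\<dots> \<le> L / (2 * real m) + (L * real m / 2) * (1 / real n)"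
    using uu L by (intro add_left_mono mult_left_mono divide_right_mono) auto
  also have "\<dots> = L / real m"
    using m by (simp add: n power2_eq_square field_simps)
  finally show ?thesis by (simp add: n_def)
qed

section \<open>Cosine polynomials and their coefficients\<close>

definition cosine_poly :: "nat \<Rightarrow> (real \<Rightarrow> real) \<Rightarrow> bool" where
  "cosine_poly n f \<longleftrightarrow> (\<exists>c. \<forall>x. f x = (\<Sum>k\<le>n. c k * cos (2 * pi * real k * x)))"

lemma cosine_poly_sum:
  assumes "finite A" "\<And>a. a \<in> A \<Longrightarrow> cosine_poly n (f a)"
  shows "cosine_poly n (\<lambda>x. \<Sum>a\<in>A. f a x)"
proof -
  obtain c where c: "\<And>a x. a \<in> A \<Longrightarrow> f a x = (\<Sum>k\<le>n. c a k * cos (2 * pi * real k * x))"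
    using assms(2) unfolding cosine_poly_def by metis
  have "(\<Sum>a\<in>A. f a x) = (\<Sum>k\<le>n. (\<Sum>a\<in>A. c a k) * cos (2 * pi * real k * x))" for x
    by (simp add: c sum_distrib_right sum.swap[of _ A])
  then show ?thesis unfolding cosine_poly_def by (intro exI[of _ "\<lambda>k. \<Sum>a\<in>A. c a k"]) simp
qed

lemma cosine_poly_scale:
  assumes "cosine_poly n f"
  shows "cosine_poly n (\<lambda>x. a * f x)"
proof -
  obtain c where "\<And>x. f x = (\<Sum>k\<le>n. c k * cos (2 * pi * real k * x))"
    using assms unfolding cosine_poly_def by blast
  then show ?thesis unfolding cosine_poly_def
    by (intro exI[of _ "\<lambda>k. a * c k"]) (simp add: sum_distrib_left mult_ac)
qed

lemma cosine_poly_cos: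
  assumes "k \<le> n"
  shows "cosine_poly n (\<lambda>x. cos (2 * pi * real k * x))"
  unfolding cosine_poly_def
  using assms by (intro exI[of _ "\<lambda>j. of_bool (j = k)"])
    (auto simp: of_bool_def if_distrib[of "\<lambda>t. t * _"] sum.delta cong: if_cong)

lemma cosine_poly_add:
  assumes "cosine_poly n f" "cosine_poly n g"
  shows "cosine_poly n (\<lambda>x. f x + g x)"
  using cosine_poly_sum[of "UNIV :: bool set" n "\<lambda>b. if b then f else g"] assms
  by (simp add: UNIV_bool add.commute)

lemma cosine_poly_mult:
  assumes "cosine_poly m f" "cosine_poly n g"
  shows "cosine_poly (m + n) (\<lambda>x. f x * g x)"
proof -
  obtain c d where c: "\<And>x. f x = (\<Sum>k\<le>m. c k * cos (2 * pi * real k * x))"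
    and d: "\<And>x. g x = (\<Sum>k\<le>n. d k * cos (2 * pi * real k * x))"
    using assms unfolding cosine_poly_def by blast
  have cc: "cosine_poly (m + n) (\<lambda>x. cos (2 * pi * real k * x) * cos (2 * pi * real l * x))"
    if "k \<le> m" "l \<le> n" for k l
  proof -
    \<comment> \<open>The absolute difference of the frequencies, legitimate because cosine is
      even.\<close>
    define r where "r = (if k \<le> l then l - k else k - l)"
    have r: "cos (2 * pi * real k * x - 2 * pi * real l * x) = cos (2 * pi * real r * x)" for x
    proof (cases "k \<le> l")
      case True
      then have "2 * pi * real k * x - 2 * pi * real l * x = - (2 * pi * real r * x)"
        by (simp add: r_def of_nat_diff algebra_simps)
      then show ?thesis by (metis cos_minus)
    next
      case False
      then show ?thesis by (simp add: r_def of_nat_diff algebra_simps)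
    qed
    have "cos (2 * pi * real k * x) * cos (2 * pi * real l * x)
        = 1/2 * (cos (2 * pi * real r * x) + cos (2 * pi * real (k + l) * x))" for x
      by (simp only: cos_times_cos r) (simp add: algebra_simps)
    then show ?thesis
      using that by (simp only:) (intro cosine_poly_scale cosine_poly_add cosine_poly_cos; auto simp: r_def)
  qed
  have "f x * g x = (\<Sum>p\<in>{..m} \<times> {..n}. (c (fst p) * d (snd p)) *
      (cos (2 * pi * real (fst p) * x) * cos (2 * pi * real (snd p) * x)))" for x
    by (simp add: c d sum_product sum.cartesian_product split_def mult_ac)
  then show ?thesis
    by (simp only:) (intro cosine_poly_sum cosine_poly_scale cc; auto)
qed

lemma cosine_poly_power:
  assumes "cosine_poly 1 f"
  shows "cosine_poly k (\<lambda>x. f x ^ k)"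
proof (induction k)
  case 0
  show ?case using cosine_poly_cos[of 0 0] by simp
next
  case (Suc k)
  show ?case using cosine_poly_mult[OF assms Suc.IH] by simp
qed

text \<open>Both \<open>sin\<^sup>2 (\<pi> x)\<close> and its complement to 1 are cosine polynomials
  of degree 1, so the substitution preserves the degree \<open>n\<close>.\<close>

lemma cosine_poly_Bernstein:
  assumes "k \<le> n"
  shows "cosine_poly n (\<lambda>x. Bernstein n k ((sin (pi * x))\<^sup>2))"
proof -
  have eq: "(sin (pi * x))\<^sup>2 = 1/2 * cos (2 * pi * real 0 * x) + (- 1/2) * cos (2 * pi * real 1 * x)"
       "1 - (sin (pi * x))\<^sup>2 = 1/2 * cos (2 * pi * real 0 * x) + 1/2 * cos (2 * pi * real 1 * x)" for x
    using cos_double_sin[of "pi * x"] by (simp_all add: mult.assoc field_simps)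
  have "cosine_poly 1 (\<lambda>x. (sin (pi * x))\<^sup>2)" "cosine_poly 1 (\<lambda>x. 1 - (sin (pi * x))\<^sup>2)"
    by (simp_all only: eq(2)) (simp_all only: eq(1), (intro cosine_poly_add cosine_poly_scale cosine_poly_cos; simp)+)
  then have "cosine_poly (k + (n - k)) (\<lambda>x. ((sin (pi * x))\<^sup>2) ^ k * (1 - (sin (pi * x))\<^sup>2) ^ (n - k))"
    by (intro cosine_poly_mult cosine_poly_power)
  from cosine_poly_scale[OF this, of "of_nat (n choose k)"] assms show ?thesis
    by (simp add: Bernstein_def mult.assoc)
qed

text \<open>The second part is Bessel's inequality; the factor 2 appears because
  \<open>cos\<^sup>2\<close> has mean 1/2 at nonzero frequencies.\<close>

lemma cosine_poly_coeff_integrals: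
  fixes c :: "nat \<Rightarrow> real" and n :: nat
  defines "P \<equiv> \<lambda>x. \<Sum>k\<le>n. c k * cos (2 * pi * real k * x)"
  shows "(\<integral>x. P x \<partial>lebesgue_on {0..1}) = c 0"
    and "(\<Sum>k\<in>{1..n}. (c k)\<^sup>2) \<le> 2 * (\<integral>x. (P x)\<^sup>2 \<partial>lebesgue_on {0..1})"
proof -
  have int: "integrable (lebesgue_on {0..1}) (\<lambda>x. cos (2 * pi * of_int k * x))" for k
    by (intro integrable_continuous_unit continuous_intros)
  have cos1: "(\<integral>x. cos (2 * pi * real k * x) \<partial>lebesgue_on {0..1}) = of_bool (k = 0)" for k
    using integral_cos_int[of "int k"] by simp
  have "(\<integral>x. P x \<partial>lebesgue_on {0..1}) = (\<Sum>k\<le>n. c k * of_bool (k = 0))"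
    unfolding P_def using int[of "int _"]
    by (subst Bochner_Integration.integral_sum) (auto simp: cos1)
  then show "(\<integral>x. P x \<partial>lebesgue_on {0..1}) = c 0"
    by (simp add: of_bool_def if_distrib[of "\<lambda>t. _ * t"] sum.delta cong: if_cong)
  have sq: "(P x)\<^sup>2 = (\<Sum>k\<le>n. \<Sum>l\<le>n. c k * c l / 2 *
      (cos (2 * pi * of_int (int k - int l) * x) + cos (2 * pi * of_int (int k + int l) * x)))" for x
    unfolding P_def power2_eq_square sum_product
  proof (intro sum.cong refl)
    fix k l
    have "2 * pi * of_int (int k - int l) * x = 2 * pi * real k * x - 2 * pi * real l * x"
      "2 * pi * of_int (int k + int l) * x = 2 * pi * real k * x + 2 * pi * real l * x"
      by (simp_all add: algebra_simps)
    then have "cos (2 * pi * of_int (int k - int l) * x) + cos (2 * pi * of_int (int k + int l) * x)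
        = 2 * (cos (2 * pi * real k * x) * cos (2 * pi * real l * x))"
      by (simp only: cos_times_cos) simp
    then show "c k * cos (2 * pi * real k * x) * (c l * cos (2 * pi * real l * x)) = c k * c l / 2 *
      (cos (2 * pi * of_int (int k - int l) * x) + cos (2 * pi * of_int (int k + int l) * x))"
      by (simp only:) simp
  qed
  have "(\<integral>x. (P x)\<^sup>2 \<partial>lebesgue_on {0..1})
      = (\<Sum>k\<le>n. \<Sum>l\<le>n. c k * c l / 2 * (of_bool (int k - int l = 0) + of_bool (int k + int l = 0)))"
    unfolding sq
    by (subst Bochner_Integration.integral_sum)
       (auto intro!: int simp: integral_cos_int Bochner_Integration.integral_sum int simp del: of_int_diff of_int_add)
  \<comment> \<open>Terms off the diagonal vanish. On it the first indicator already gives the half,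
    and the second, present only at \<open>k = l = 0\<close>, adds a nonnegative amount.\<close>
  also have "\<dots> \<ge> (\<Sum>k\<le>n. \<Sum>l\<le>n. if k = l then (c k)\<^sup>2 / 2 else 0)"
    by (intro sum_mono) (auto simp: power2_eq_square)
  finally have "(\<Sum>k\<le>n. (c k)\<^sup>2 / 2) \<le> (\<integral>x. (P x)\<^sup>2 \<partial>lebesgue_on {0..1})" by simp
  moreover have "(\<Sum>k\<in>{1..n}. (c k)\<^sup>2 / 2) \<le> (\<Sum>k\<le>n. (c k)\<^sup>2 / 2)"
    by (intro sum_mono2) auto
  ultimately show "(\<Sum>k\<in>{1..n}. (c k)\<^sup>2) \<le> 2 * (\<integral>x. (P x)\<^sup>2 \<partial>lebesgue_on {0..1})"
    by (simp add: sum_divide_distrib[symmetric])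
qed

section \<open>Approximating the indicator of a neighbourhood of the integers\<close>

lemma dist_nearest_int_le_half: "dist_nearest_int y \<le> 1 / 2"
  unfolding dist_nearest_int_def using of_int_round_abs_le[of y] by (simp add: abs_minus_commute)

text \<open>Squaring removes the sign produced by an integer shift. Together with
  \<open>sin_sq_mono\<close> this lets conditions on the distance to the integers be read as
  conditions on the Bernstein variable.\<close>

lemma sin_sq_dist_nearest_int: "(sin (pi * y))\<^sup>2 = (sin (pi * dist_nearest_int y))\<^sup>2"
proof -
  have "pi * y = pi * (y - of_int (round y)) + of_int (round y) * pi" by (simp add: algebra_simps)
  moreover have "sin (of_int (round y) * pi) = 0" by (metis sin_zero_iff_int2)
  moreover from this have "(cos (of_int (round y) * pi))\<^sup>2 = 1"
    using sin_cos_squared_add[of "of_int (round y) * pi"] by simp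
  ultimately have "(sin (pi * y))\<^sup>2 = (sin (pi * (y - of_int (round y))))\<^sup>2"
    by (simp only: sin_add) (simp add: power_mult_distrib)
  then show ?thesis
    by (simp add: dist_nearest_int_def abs_if) (metis minus_diff_eq mult_minus_right power2_minus sin_minus)
qed

lemma sin_sq_mono:
  assumes "0 \<le> s" "s \<le> t" "t \<le> 1 / 2"
  shows "(sin (pi * s))\<^sup>2 \<le> (sin (pi * t))\<^sup>2"
proof (rule power_mono)
  have "pi * t \<le> pi * (1/2)" "pi * s \<le> pi * t" "0 \<le> pi * s" using assms by (auto intro: mult_left_mono)
  moreover have "pi > 0" by simp
  ultimately have "- (pi / 2) \<le> pi * s" "pi * s \<le> pi * t" "pi * t \<le> pi / 2" "0 \<le> pi * s" "pi * s \<le> pi"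
    by linarith+
  then show "sin (pi * s) \<le> sin (pi * t)" "0 \<le> sin (pi * s)"
    using sin_monotone_2pi_le sin_ge_zero by blast+
qed

text \<open>\<open>\<eta>\<close> is the Bernstein error for a ramp that falls from 1 to 0 between
  the values of \<open>sin\<^sup>2\<close> at \<open>\<delta>\<close> and \<open>\<delta>'\<close>.
  The mean \<open>c 0\<close> is compared with the measures of two neighbourhoods of the integers.
  The last bound is Bessel's inequality with \<open>P^2 \<le> P\<close>, valid for values in
  \<open>{0..1}\<close>: the squares sum to the order of the mean, not merely to a constant.\<close>

lemma ex_cosine_ramp:
  assumes \<delta>: "0 < \<delta>" "\<delta> < \<delta>'" "\<delta>' < 1 / 2" and m: "m > (0::nat)"
  defines "\<eta> \<equiv> 1 / (real m * ((sin (pi * \<delta>'))\<^sup>2 - (sin (pi * \<delta>))\<^sup>2))"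
  assumes pos: "(sin (pi * \<delta>))\<^sup>2 < (sin (pi * \<delta>'))\<^sup>2"
  obtains c :: "nat \<Rightarrow> real" where
    "\<And>y. dist_nearest_int y \<le> \<delta> \<Longrightarrow> (\<Sum>k\<le>m\<^sup>2. c k * cos (2 * pi * real k * y)) \<ge> 1 - \<eta>"
    "\<And>y. dist_nearest_int y \<ge> \<delta>' \<Longrightarrow> (\<Sum>k\<le>m\<^sup>2. c k * cos (2 * pi * real k * y)) \<le> \<eta>"
    "\<And>y. (\<Sum>k\<le>m\<^sup>2. c k * cos (2 * pi * real k * y)) \<in> {0..1}"
    "2 * \<delta> - \<eta> \<le> c 0" "c 0 \<le> 2 * \<delta>' + \<eta>"
    "(\<Sum>k\<in>{1..m\<^sup>2}. (c k)\<^sup>2) \<le> 2 * c 0"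
proof -
  define n where "n = m\<^sup>2"
  define \<alpha> where "\<alpha> = (sin (pi * \<delta>))\<^sup>2"
  define \<alpha>' where "\<alpha>' = (sin (pi * \<delta>'))\<^sup>2"
  have \<alpha>: "\<alpha> < \<alpha>'" using pos by (simp add: \<alpha>_def \<alpha>'_def)
  define h where "h u = max 0 (min 1 ((\<alpha>' - u) / (\<alpha>' - \<alpha>)))" for u
  define L where "L = 1 / (\<alpha>' - \<alpha>)"
  have L: "L \<ge> 0" using \<alpha> by (simp add: L_def)
  have \<eta>: "\<eta> = L / real m" by (simp add: \<eta>_def L_def \<alpha>_def \<alpha>'_def)
  have lip: "\<bar>h s - h t\<bar> \<le> L * \<bar>s - t\<bar>" for s t
  proof -
    have "\<bar>h s - h t\<bar> \<le> \<bar>(\<alpha>' - s) / (\<alpha>' - \<alpha>) - (\<alpha>' - t) / (\<alpha>' - \<alpha>)\<bar>"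
      unfolding h_def by linarith
    also have "(\<alpha>' - s) / (\<alpha>' - \<alpha>) - (\<alpha>' - t) / (\<alpha>' - \<alpha>) = L * (t - s)"
      by (simp add: L_def diff_divide_distrib[symmetric])
    also have "\<bar>L * (t - s)\<bar> = L * \<bar>s - t\<bar>" using L by (simp add: abs_mult abs_minus_commute)
    finally show ?thesis .
  qed
  have h01: "h u \<in> {0..1}" for u by (auto simp: h_def)
  have h1: "h u = 1" if "u \<le> \<alpha>" for u using that \<alpha> by (simp add: h_def field_simps min_def max_def)
  have h0: "h u = 0" if "u \<ge> \<alpha>'" for u
  proof -
    have "(\<alpha>' - u) / (\<alpha>' - \<alpha>) \<le> 0" using that \<alpha> by (intro divide_nonpos_pos) auto
    then show ?thesis by (simp add: h_def)
  qed
  define B where "B u = (\<Sum>k\<le>n. h (real k / real n) * Bernstein n k u)" for u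
  have err: "\<bar>h u - B u\<bar> \<le> \<eta>" if "0 \<le> u" "u \<le> 1" for u
    unfolding B_def n_def \<eta> using Bernstein_abs_error_le[OF m that lip L] .
  \<comment> \<open>The Bernstein weights average the values of \<open>h\<close>, so the range is
    preserved.\<close>
  have B01: "B u \<in> {0..1}" if "0 \<le> u" "u \<le> 1" for u
  proof -
    have "B u \<le> (\<Sum>k\<le>n. 1 * Bernstein n k u)"
      unfolding B_def using h01 that by (intro sum_mono mult_right_mono Bernstein_nonneg) auto
    moreover have "0 \<le> B u"
      unfolding B_def using h01 that by (intro sum_nonneg mult_nonneg_nonneg Bernstein_nonneg) auto
    ultimately show ?thesis by simp
  qed
  define P where "P y = B ((sin (pi * y))\<^sup>2)" for y
  have "cosine_poly n P"
    unfolding P_def B_def by (intro cosine_poly_sum cosine_poly_scale cosine_poly_Bernstein) auto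
  then obtain c where c: "\<And>y. P y = (\<Sum>k\<le>n. c k * cos (2 * pi * real k * y))"
    unfolding cosine_poly_def by blast
  have u01: "0 \<le> (sin (pi * y))\<^sup>2" "(sin (pi * y))\<^sup>2 \<le> 1" for y
    by (auto simp: abs_square_le_1)
  have d0: "dist_nearest_int y \<ge> 0" for y by (simp add: dist_nearest_int_def)
  have P1: "P y \<ge> 1 - \<eta>" if "dist_nearest_int y \<le> \<delta>" for y
  proof -
    have "(sin (pi * y))\<^sup>2 \<le> \<alpha>"
      unfolding sin_sq_dist_nearest_int[of y] \<alpha>_def using that \<delta> d0 by (intro sin_sq_mono) auto
    with h1 err[OF u01, of y] show ?thesis by (simp add: P_def)
  qed
  have P0: "P y \<le> \<eta>" if "dist_nearest_int y \<ge> \<delta>'" for y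
  proof -
    have "(sin (pi * y))\<^sup>2 \<ge> \<alpha>'"
      unfolding sin_sq_dist_nearest_int[of y] \<alpha>'_def using that \<delta> dist_nearest_int_le_half
      by (intro sin_sq_mono) auto
    with h0 err[OF u01, of y] show ?thesis by (simp add: P_def)
  qed
  have P01: "P y \<in> {0..1}" for y unfolding P_def using B01 u01 by blast
  let ?L = "lebesgue_on {0..1::real}"
  have intP: "integrable ?L P" "integrable ?L (\<lambda>x. (P x)\<^sup>2)"
    unfolding c by (intro integrable_continuous_unit continuous_intros)+
  have c0: "c 0 = (\<integral>x. P x \<partial>?L)"
    unfolding c by (rule cosine_poly_coeff_integrals(1)[symmetric])
  have \<eta>0: "\<eta> \<ge> 0" using \<eta> L by simp
  \<comment> \<open>On the unit interval the points within \<open>t\<close> of an integer form two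
    end intervals of total length \<open>2 t\<close>.\<close>
  have ends: "(\<integral>x. indicator ({0..t} \<union> {1 - t..1}) x \<partial>?L) = 2 * t"
      "integrable ?L (indicator ({0..t} \<union> {1 - t..1}) :: real \<Rightarrow> real)"
    if t: "0 < t" "t < 1 / 2" for t
  proof -
    have sub: "{0..t} \<union> {1 - t..1} \<subseteq> {0..1}" using t by auto
    have m: "{0..t} \<union> {1 - t..1} \<in> sets lebesgue" by auto
    have "measure lebesgue ({0..t} \<union> {1 - t..1}) = measure lebesgue {0..t} + measure lebesgue {1 - t..1}"
      using t by (intro measure_Un3[THEN trans]) (auto simp: fmeasurable_def)
    also have "\<dots> = 2 * t" using t by simp
    finally have "measure ?L ({0..t} \<union> {1 - t..1}) = 2 * t"
      using sub m by (simp add: measure_restrict_space)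
    moreover have "{0..t} \<union> {1 - t..1} \<in> sets ?L"
      using sub m by (simp add: sets_restrict_space_iff)
    moreover have "emeasure ?L ({0..t} \<union> {1 - t..1}) \<le> emeasure ?L {0..1}"
      using sub by (intro emeasure_mono) (auto simp: sets_restrict_space_iff)
    then have "emeasure ?L ({0..t} \<union> {1 - t..1}) < \<infinity>"
      by (simp add: emeasure_restrict_space le_less_trans)
    ultimately show "(\<integral>x. indicator ({0..t} \<union> {1 - t..1}) x \<partial>?L) = 2 * t"
      "integrable ?L (indicator ({0..t} \<union> {1 - t..1}) :: real \<Rightarrow> real)"
      using sub by (auto simp: Int_absorb2)
  qed
  have one: "measure ?L {0..1} = 1" "integrable ?L (\<lambda>x. a)" for a :: real
    using integrable_continuous_unit[of "\<lambda>x. a"] by (auto simp: measure_restrict_space)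
  have near: "dist_nearest_int x \<le> t" if "x \<in> {0..t} \<union> {1 - t..1}" "t < 1 / 2" for x t
  proof -
    have "round x = 0" if "0 \<le> x" "x \<le> t"
      using that \<open>t < 1 / 2\<close> by (intro round_unique') auto
    moreover have "round x = 1" if "1 - t \<le> x" "x \<le> 1"
      using that \<open>t < 1 / 2\<close> by (intro round_unique') auto
    ultimately show ?thesis using that(1) by (auto simp: dist_nearest_int_def)
  qed
  have far: "dist_nearest_int x \<ge> t" if "x \<in> {0..1}" "x \<notin> {0..t} \<union> {1 - t..1}" "t < 1 / 2" for x t
  proof -
    have x: "t < x" "x < 1 - t" using that by auto
    consider "round x \<le> 0" | "round x \<ge> 1" by linarith
    then show ?thesis
    proof cases
      case 1
      then have "real_of_int (round x) \<le> 0" by simp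
      then show ?thesis using x by (simp add: dist_nearest_int_def)
    next
      case 2
      then have "real_of_int (round x) \<ge> 1" by simp
      then show ?thesis using x by (simp add: dist_nearest_int_def)
    qed
  qed
  have lo: "2 * \<delta> - \<eta> \<le> c 0"
  proof -
    have "(\<integral>x. indicator ({0..\<delta>} \<union> {1 - \<delta>..1}) x - \<eta> \<partial>?L) \<le> c 0"
      unfolding c0
    proof (rule integral_mono)
      fix x
      show "indicator ({0..\<delta>} \<union> {1 - \<delta>..1}) x - \<eta> \<le> P x"
        using P1[OF near[of x \<delta>]] P01[of x] \<delta> \<eta>0 by (auto simp: indicator_def)
    qed (use ends[of \<delta>] one \<delta> intP in auto)
    then show ?thesis using ends[of \<delta>] one \<delta> by (subst (asm) Bochner_Integration.integral_diff) auto
  qed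
  have hi: "c 0 \<le> 2 * \<delta>' + \<eta>"
  proof -
    have "c 0 \<le> (\<integral>x. indicator ({0..\<delta>'} \<union> {1 - \<delta>'..1}) x + \<eta> \<partial>?L)"
      unfolding c0
    proof (rule integral_mono)
      fix x assume "x \<in> space ?L"
      then show "P x \<le> indicator ({0..\<delta>'} \<union> {1 - \<delta>'..1}) x + \<eta>"
        using P0[OF far[of x \<delta>']] P01[of x] \<delta> \<eta>0 by (auto simp: indicator_def)
    qed (use ends[of \<delta>'] one \<delta> intP in auto)
    then show ?thesis using ends[of \<delta>'] one \<delta> by (subst (asm) Bochner_Integration.integral_add) auto
  qed
  have "(\<Sum>k\<in>{1..n}. (c k)\<^sup>2) \<le> 2 * (\<integral>x. (P x)\<^sup>2 \<partial>?L)"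
    unfolding c by (rule cosine_poly_coeff_integrals(2))
  also have "(\<integral>x. (P x)\<^sup>2 \<partial>?L) \<le> c 0"
    unfolding c0 using P01 by (intro integral_mono intP) (simp add: power2_eq_square mult_left_le)
  finally have sq: "(\<Sum>k\<in>{1..n}. (c k)\<^sup>2) \<le> 2 * c 0" by simp
  show ?thesis
    using that[of c] P1 P0 P01 lo hi sq unfolding c n_def by blast
qed

lemma sin_ge_half:
  assumes "0 \<le> t" "t \<le> (1::real)"
  shows "t / 2 \<le> sin t"
proof -
  have "(\<lambda>t. sin t - t / 2) 0 \<le> (\<lambda>t. sin t - t / 2) t"
  proof (rule DERIV_nonneg_imp_nondecreasing[OF assms(1)])
    fix x assume x: "0 \<le> x" "x \<le> t"
    \<comment> \<open>Here \<open>x \<le> 1 < \<pi> / 3\<close>, where cosine is still at least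
      1/2.\<close>
    have "cos (pi / 3) \<le> cos x"
      using x assms pi_gt3 by (intro cos_monotone_0_pi_le) auto
    then have "cos x - 1 / 2 \<ge> 0" by (simp add: cos_60)
    moreover have "((\<lambda>t. sin t - t / 2) has_real_derivative cos x - 1 / 2) (at x)"
      by (auto intro!: derivative_eq_intros)
    ultimately show "\<exists>y. ((\<lambda>t. sin t - t / 2) has_real_derivative y) (at x) \<and> 0 \<le> y" by blast
  qed
  then show ?thesis by simp
qed

lemma sin_sq_diff: "(sin (b::real))\<^sup>2 - (sin a)\<^sup>2 = sin (b + a) * sin (b - a)"
proof -
  have "sin (b + a) * sin (b - a) = (sin b)\<^sup>2 * (cos a)\<^sup>2 - (cos b)\<^sup>2 * (sin a)\<^sup>2"
    by (simp add: sin_add sin_diff power2_eq_square algebra_simps)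
  also have "\<dots> = (sin b)\<^sup>2 - (sin a)\<^sup>2"
    by (simp add: cos_squared_eq algebra_simps)
  finally show ?thesis ..
qed

text \<open>The degree is \<open>N ^ 8\<close> because the ramp in \<open>sin\<^sup>2\<close> has slope at most a constant times \<open>N\<^sup>2\<close>
  and the Bernstein polynomial of degree \<open>m\<^sup>2\<close> has error at most slope over \<open>m\<close>; with \<open>m = N ^ 4\<close>
  this is below \<open>1 / N\<close>.\<close>

definition ramp_coeffs :: "real \<Rightarrow> real \<Rightarrow> real \<Rightarrow> nat \<Rightarrow> (nat \<Rightarrow> real) \<Rightarrow> bool" where
  "ramp_coeffs \<beta> p q N c \<longleftrightarrow>
     (\<forall>y. dist_nearest_int y \<le> p / real N powr \<beta> \<longrightarrow>
        (\<Sum>k\<le>N ^ 8. c k * cos (2 * pi * real k * y)) \<ge> 1 - 1 / real N) \<and>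
     (\<forall>y. dist_nearest_int y \<ge> q / real N powr \<beta> \<longrightarrow>
        (\<Sum>k\<le>N ^ 8. c k * cos (2 * pi * real k * y)) \<le> 1 / real N) \<and>
     (\<forall>y. (\<Sum>k\<le>N ^ 8. c k * cos (2 * pi * real k * y)) \<in> {0..1}) \<and>
     2 * p / real N powr \<beta> - 1 / real N \<le> c 0 \<and>
     c 0 \<le> 2 * q / real N powr \<beta> + 1 / real N \<and>
     (\<Sum>k\<in>{1..N ^ 8}. (c k)\<^sup>2) \<le> 2 * c 0"

lemma eventually_ramp_coeffs:
  assumes \<beta>: "0 < \<beta>" "\<beta> < 1" and pq: "0 < p" "p < q"
  shows "\<forall>\<^sub>F N in sequentially. \<exists>c. ramp_coeffs \<beta> p q N c"
proof -
  \<comment> \<open>Eventually \<open>\<pi> (\<delta>' + \<delta>)\<close> and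
    \<open>\<pi> (\<delta>' - \<delta>)\<close> are below 1, where \<open>sin t \<ge> t / 2\<close>
    is available; this also forces \<open>\<delta>' < 1 / 2\<close>.\<close>
  have "(\<lambda>N. pi * ((q + p) * real N powr - \<beta>)) \<longlonglongrightarrow> pi * ((q + p) * 0)"
    using \<beta> by (intro tendsto_intros tendsto_neg_powr filterlim_real_sequentially) auto
  then have e1: "\<forall>\<^sub>F N in sequentially. pi * ((q + p) * real N powr - \<beta>) < 1"
    by (rule order_tendstoD) simp
  \<comment> \<open>The constant in the difference of the squared radii; for
    \<open>N \<ge> 1 / \<kappa>\<close> a spare factor \<open>N\<close> absorbs it.\<close>
  define \<kappa> where "\<kappa> = q\<^sup>2 - p\<^sup>2"
  have \<kappa>: "\<kappa> > 0" using pq by (simp add: \<kappa>_def power_strict_mono)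
  have e2: "\<forall>\<^sub>F N in sequentially. real N \<ge> 1 / \<kappa>"
    using filterlim_real_sequentially by (simp add: filterlim_at_top)
  from e1 e2 eventually_gt_at_top[of 0] show ?thesis
  proof eventually_elim
    case (elim N)
    define \<delta> where "\<delta> = p / real N powr \<beta>"
    define \<delta>' where "\<delta>' = q / real N powr \<beta>"
    have N: "real N \<ge> 1" "real N > 0" using elim by auto
    have d: "0 < \<delta>" "\<delta> < \<delta>'" using N pq by (auto simp: \<delta>_def \<delta>'_def divide_strict_right_mono)
    have s1: "pi * (\<delta>' + \<delta>) < 1"
      using elim(1) by (simp add: \<delta>_def \<delta>'_def powr_minus field_simps add_divide_distrib)
    have "3 * \<delta>' \<le> pi * \<delta>'" using pi_gt3 d by (intro mult_right_mono) auto
    also have "\<dots> \<le> pi * (\<delta>' + \<delta>)" using d by simp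
    finally have half: "\<delta>' < 1 / 2" using s1 by linarith
    have "pi * (\<delta>' - \<delta>) \<le> pi * (\<delta>' + \<delta>)" using d by simp
    then have s2: "pi * (\<delta>' - \<delta>) < 1" using s1 by linarith
    define D where "D = (sin (pi * \<delta>'))\<^sup>2 - (sin (pi * \<delta>))\<^sup>2"
    \<comment> \<open>Factoring the difference of squares lets each sine be bounded below by half
      its argument.\<close>
    have "D = sin (pi * (\<delta>' + \<delta>)) * sin (pi * (\<delta>' - \<delta>))"
      unfolding D_def sin_sq_diff by (simp add: algebra_simps)
    also have "\<dots> \<ge> (pi * (\<delta>' + \<delta>) / 2) * (pi * (\<delta>' - \<delta>) / 2)"
      using d s1 s2 by (intro mult_mono sin_ge_half order_trans[OF _ sin_ge_half]) auto
    finally have "D \<ge> (pi * (\<delta>' + \<delta>) / 2) * (pi * (\<delta>' - \<delta>) / 2)" .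
    moreover have "(pi * (\<delta>' + \<delta>) / 2) * (pi * (\<delta>' - \<delta>) / 2) = (pi / 2)\<^sup>2 * (\<delta>'\<^sup>2 - \<delta>\<^sup>2)"
      by (simp add: power2_eq_square field_simps)
    moreover have "1 * (\<delta>'\<^sup>2 - \<delta>\<^sup>2) \<le> (pi / 2)\<^sup>2 * (\<delta>'\<^sup>2 - \<delta>\<^sup>2)"
      using d pi_gt3 by (intro mult_right_mono) (auto simp: power_mono one_le_power)
    moreover have "\<delta>'\<^sup>2 - \<delta>\<^sup>2 = \<kappa> / real N powr (2 * \<beta>)"
      using N by (simp add: \<delta>_def \<delta>'_def \<kappa>_def power_divide diff_divide_distrib powr_power mult.commute)
    \<comment> \<open>As \<open>\<beta> < 1\<close>, the exponent \<open>2 \<beta>\<close> can be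
      coarsened to 2, so one degree serves all \<open>\<beta>\<close>.\<close>
    moreover have "\<kappa> / real N powr (2 * \<beta>) \<ge> \<kappa> / real N powr 2"
      using N \<kappa> \<beta> by (intro divide_left_mono powr_mono) auto
    moreover have "real N powr 2 = (real N)\<^sup>2" using N by simp
    ultimately have D: "D \<ge> \<kappa> / (real N)\<^sup>2" by (simp only: mult_1)
    have "\<kappa> / (real N)\<^sup>2 > 0" using \<kappa> N by simp
    with D have D0: "D > 0" by linarith
    have "real (N ^ 4) * D \<ge> real (N ^ 4) * (\<kappa> / (real N)\<^sup>2)"
      using D by (intro mult_left_mono) auto
    also have "real (N ^ 4) * (\<kappa> / (real N)\<^sup>2) = real N * (real N * \<kappa>)"
      using N by (simp add: field_simps power2_eq_square power4_eq_xxxx)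
    also have "\<dots> \<ge> real N * 1"
      using elim(2) \<kappa> N by (intro mult_left_mono) (auto simp: field_simps)
    finally have "real (N ^ 4) * D \<ge> real N" by simp
    then have \<eta>: "1 / (real (N ^ 4) * D) \<le> 1 / real N"
      using N D0 by (intro divide_left_mono) auto
    have N4: "N ^ 4 > 0" "(N ^ 4)\<^sup>2 = N ^ 8" using N by (auto simp: power_mult[symmetric])
    obtain c where c:
      "\<And>y. dist_nearest_int y \<le> \<delta> \<Longrightarrow> (\<Sum>k\<le>N ^ 8. c k * cos (2 * pi * real k * y)) \<ge> 1 - 1 / (real (N ^ 4) * D)"
      "\<And>y. dist_nearest_int y \<ge> \<delta>' \<Longrightarrow> (\<Sum>k\<le>N ^ 8. c k * cos (2 * pi * real k * y)) \<le> 1 / (real (N ^ 4) * D)"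
      "\<And>y. (\<Sum>k\<le>N ^ 8. c k * cos (2 * pi * real k * y)) \<in> {0..1}"
      "2 * \<delta> - 1 / (real (N ^ 4) * D) \<le> c 0" "c 0 \<le> 2 * \<delta>' + 1 / (real (N ^ 4) * D)"
      "(\<Sum>k\<in>{1..N ^ 8}. (c k)\<^sup>2) \<le> 2 * c 0"
      using ex_cosine_ramp[OF d half N4(1)] D0 unfolding D_def N4(2) by auto
    have "ramp_coeffs \<beta> p q N c"
      unfolding ramp_coeffs_def times_divide_eq_right[symmetric] \<delta>_def[symmetric] \<delta>'_def[symmetric]
      using c(3,6) order_trans[OF _ c(1)] order_trans[OF c(2)] order_trans[OF _ c(4)] order_trans[OF c(5)] \<eta>
      by auto
    then show ?case by blast
  qed
qed

section \<open>Variance of the smoothed pair count\<close>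

definition offdiag :: "nat \<Rightarrow> (nat \<times> nat) set" where
  "offdiag N = {(i, j). i \<in> {1..N} \<and> j \<in> {1..N} \<and> i \<noteq> j}"

lemma finite_offdiag: "finite (offdiag N)"
  by (rule finite_subset[of _ "{1..N} \<times> {1..N}"]) (auto simp: offdiag_def)

lemma card_offdiag: "real (card (offdiag N)) = (real N)\<^sup>2 - real N"
proof -
  have "offdiag N = {1..N} \<times> {1..N} - (\<lambda>i. (i, i)) ` {1..N}"
    by (auto simp: offdiag_def)
  moreover have "card ({1..N} \<times> {1..N} - (\<lambda>i. (i, i)) ` {1..N})
      = card ({1..N} \<times> {1..N}) - card ((\<lambda>i. (i, i)) ` {1..N})"
    by (intro card_Diff_subset) auto
  moreover have "card ((\<lambda>i. (i, i)) ` {1..N}) = N"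
    by (subst card_image) (auto simp: inj_on_def)
  ultimately show ?thesis
    by (simp add: card_cartesian_product power2_eq_square of_nat_diff)
qed

text \<open>Unsigned because cosine is even and the variance bound works with positive integer
  dilations.\<close>

definition gap :: "(nat \<Rightarrow> nat) \<Rightarrow> nat \<times> nat \<Rightarrow> nat" where
  "gap a p = nat \<bar>int (a (fst p)) - int (a (snd p))\<bar>"

text \<open>Once \<open>p\<close> and the first index of \<open>q\<close> are fixed, the common gap
  and the sign of the difference determine \<open>a\<close> at the second index, hence that index.
  The Boolean in the encoding \<open>g\<close> is this sign.\<close>

lemma card_equal_gaps:
  assumes "inj_on a {1..N}"
  shows "card {(p, q). p \<in> offdiag N \<and> q \<in> offdiag N \<and> gap a p = gap a q} \<le> 2 * N ^ 3"
proof -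
  let ?E = "{(p, q). p \<in> offdiag N \<and> q \<in> offdiag N \<and> gap a p = gap a q}"
  let ?T = "({1..N} \<times> {1..N}) \<times> {1..N} \<times> (UNIV :: bool set)"
  define g where "g = (\<lambda>(p :: nat \<times> nat, q). (p, fst q, a (fst q) < a (snd q)))"
  have "inj_on g ?E"
  proof (rule inj_onI)
    fix z z' assume z: "z \<in> ?E" and z': "z' \<in> ?E" and eq: "g z = g z'"
    obtain p i j where z1: "z = (p, i, j)" by (cases z) auto
    obtain p' i' j' where z2: "z' = (p', i', j')" by (cases z') auto
    have "p = p'" "i = i'" "a i < a j \<longleftrightarrow> a i' < a j'" using eq by (auto simp: g_def z1 z2)
    moreover have "gap a (i, j) = gap a p" "gap a (i', j') = gap a p'" using z z' by (auto simp: z1 z2)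
    ultimately have "a j = a j'" by (auto simp: gap_def)
    moreover have "j \<in> {1..N}" "j' \<in> {1..N}" using z z' by (auto simp: z1 z2 offdiag_def)
    ultimately have "j = j'" using assms by (auto dest: inj_onD)
    with \<open>p = p'\<close> \<open>i = i'\<close> show "z = z'" by (simp add: z1 z2)
  qed
  moreover have "g ` ?E \<subseteq> ?T" by (auto simp: g_def offdiag_def)
  ultimately have "card ?E \<le> card ?T" by (intro card_inj_on_le) auto
  also have "\<dots> = 2 * N ^ 3" by (simp add: card_cartesian_product power3_eq_cube)
  finally show ?thesis .
qed

text \<open>The smoothed pair count with the constant coefficient \<open>c 0\<close> removed: for
  distinct values of \<open>a\<close>, its deviation from its mean in \<open>x\<close>.\<close>

definition fluctuation :: "(nat \<Rightarrow> nat) \<Rightarrow> (nat \<Rightarrow> real) \<Rightarrow> nat \<Rightarrow> real \<Rightarrow> real" where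
  "fluctuation a c N x =
     (\<Sum>r\<in>offdiag N. \<Sum>k\<in>{1..N ^ 8}. c k * cos (2 * pi * real k * (real (gap a r) * x)))"

text \<open>The squared normalisation is \<open>N powr (4 - 2 * \<beta>)\<close>, so this bound wins
  a factor \<open>N powr ((1 - \<beta>) / 2)\<close>. It arises from \<open>V\<close> of order
  \<open>N powr (2 * \<epsilon> - \<beta>)\<close> against at most \<open>2 * N ^ 3\<close> pairs of
  equal gaps.\<close>

lemma fluctuation_variance:
  assumes inj: "inj_on a {1..}" and \<beta>: "0 < \<beta>" "\<beta> < 1" and pq: "0 < p" "p < q"
  shows "\<exists>A\<ge>0. \<forall>N\<ge>1. \<forall>c. ramp_coeffs \<beta> p q N c \<longrightarrow>
     (\<integral>x. (fluctuation a c N x)\<^sup>2 \<partial>lebesgue_on {0..1}) \<le> A * real N powr (3 - \<beta> + (1 - \<beta>) / 2)"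
proof -
  \<comment> \<open>Two losses of \<open>N powr \<epsilon>\<close>, one from the divisor bound and
    one from the room in \<open>V\<close>, together use half of the available
    \<open>1 - \<beta>\<close>.\<close>
  define \<epsilon> where "\<epsilon> = (1 - \<beta>) / 4"
  have \<epsilon>: "\<epsilon> > 0" using \<beta> by (simp add: \<epsilon>_def)
  \<comment> \<open>With \<open>\<epsilon> * l \<ge> 1\<close> the factor
    \<open>(N powr - \<epsilon>) ^ l\<close> saves a full \<open>N\<close> on the trivial count
    \<open>N ^ 4\<close>.\<close>
  define l where "l = nat \<lceil>1 / \<epsilon>\<rceil>"
  have l: "real l \<ge> 1 / \<epsilon>" unfolding l_def by (rule real_nat_ceiling_ge)
  then have l1: "\<epsilon> * real l \<ge> 1" using \<epsilon> by (simp add: field_simps)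
  then have l1: "l \<ge> 1" "\<epsilon> * real l \<ge> 1" by (cases l; simp)+
  \<comment> \<open>Divisors are counted for integers up to \<open>N ^ (8 * l)\<close>, and this
    exponent turns the bound into \<open>C * N powr \<epsilon>\<close>.\<close>
  define \<eta> where "\<eta> = \<epsilon> / (8 * real l)"
  have "\<eta> > 0" using \<epsilon> l1 by (simp add: \<eta>_def)
  then obtain C where C: "C \<ge> 1" "\<And>n. n \<ge> 1 \<Longrightarrow> real (card {d. d dvd n}) \<le> C * real n powr \<eta>"
    using divisor_bound by metis
  define A where "A = 3 * C * (4 * q + 2)"
  have "(\<integral>x. (fluctuation a c N x)\<^sup>2 \<partial>lebesgue_on {0..1}) \<le> A * real N powr (3 - \<beta> + (1 - \<beta>) / 2)"
    if N1: "N \<ge> 1" and c: "ramp_coeffs \<beta> p q N c" for N c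
  proof -
    have N: "real N \<ge> 1" "real N > 0" using N1 by auto
    define S where "S = (\<Sum>k\<in>{1..N ^ 8}. (c k)\<^sup>2)"
    define H where "H = C * real N powr \<epsilon>"
    \<comment> \<open>\<open>Q\<close> bounds \<open>S\<close>, since
      \<open>2 * c 0 \<le> 4 * q / N powr \<beta> + 2 / N\<close> and
      \<open>1 / N \<le> N powr - \<beta>\<close>. Next, \<open>V\<close> exceeds
      \<open>H * Q\<close> by \<open>N powr \<epsilon>\<close>, which makes \<open>H * S / V\<close>
      at most \<open>N powr - \<epsilon>\<close>.\<close>
    define Q where "Q = (4 * q + 2) * real N powr - \<beta>"
    define V where "V = real N powr \<epsilon> * (H * Q)"
    have H0: "H > 0" using C N by (simp add: H_def)
    have Q0: "Q > 0" using pq N by (simp add: Q_def)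
    have V0: "V > 0" using H0 Q0 N by (simp add: V_def)
    have S0: "S \<ge> 0" by (simp add: S_def sum_nonneg)
    have "1 / real N = real N powr - 1" using N by (simp add: powr_minus_divide)
    also have "\<dots> \<le> real N powr - \<beta>" using N \<beta> by (intro powr_mono) auto
    finally have N\<beta>: "1 / real N \<le> real N powr - \<beta>" .
    have "S \<le> 2 * c 0" "c 0 \<le> 2 * q / real N powr \<beta> + 1 / real N"
      using c by (simp_all add: ramp_coeffs_def S_def)
    then have "S \<le> 2 * (2 * q / real N powr \<beta> + 1 / real N)"
      by (meson mult_left_mono order_trans zero_le_numeral)
    also have "\<dots> \<le> Q" using N\<beta> N by (simp add: Q_def powr_minus_divide algebra_simps)
    finally have SQ: "S \<le> Q" .
    have Hd: "real (card {d. d dvd n}) \<le> H" if "n \<in> {1..(N ^ 8) ^ l}" for n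
    proof -
      have "real n powr \<eta> \<le> real ((N ^ 8) ^ l) powr \<eta>"
        using that \<open>\<eta> > 0\<close> by (intro powr_mono2) (auto simp flip: of_nat_power)
      also have "real ((N ^ 8) ^ l) = real N powr (8 * real l)"
        using N powr_realpow[of "real N" "8 * l"] by (simp add: power_mult)
      also have "\<dots> powr \<eta> = real N powr \<epsilon>"
        using l1 by (simp add: powr_powr \<eta>_def)
      finally have "C * real n powr \<eta> \<le> H" using C by (simp add: H_def)
      with C(2)[of n] that show ?thesis by auto
    qed
    have gap: "gap a r > 0" if "r \<in> offdiag N" for r
    proof -
      have "a (fst r) \<noteq> a (snd r)"
        using that inj by (auto simp: offdiag_def dest: inj_onD)
      then show ?thesis by (simp add: gap_def)
    qed
    have "(\<integral>x. (fluctuation a c N x)\<^sup>2 \<partial>lebesgue_on {0..1})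
      \<le> V * real (card {(r, s). r \<in> offdiag N \<and> s \<in> offdiag N \<and> gap a r = gap a s})
        + V * (H * S / V) ^ l * (real (card (offdiag N)))\<^sup>2"
      unfolding fluctuation_def S_def
      using N1 by (intro dilated_cosine_sum_variance finite_offdiag gap Hd l1 V0) auto
    also have "\<dots> \<le> V * real (2 * N ^ 3) + V * (1 / real N) * ((real N)\<^sup>2)\<^sup>2"
    proof (intro add_mono mult_mono power_mono)
      show "real (card {(r, s). r \<in> offdiag N \<and> s \<in> offdiag N \<and> gap a r = gap a s}) \<le> real (2 * N ^ 3)"
        using card_equal_gaps[of a N] inj by (meson inj_on_subset of_nat_le_iff atLeastAtMost_iff atLeast_iff subsetI)
      show "real (card (offdiag N)) \<le> (real N)\<^sup>2" by (simp add: card_offdiag)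
      have "H * S / V \<le> H * Q / V"
        using SQ H0 V0 by (intro divide_right_mono mult_left_mono) auto
      also have "\<dots> = real N powr - \<epsilon>"
        using H0 Q0 N by (simp add: V_def powr_minus_divide)
      finally have "(H * S / V) ^ l \<le> (real N powr - \<epsilon>) ^ l"
        using H0 S0 V0 by (intro power_mono) auto
      also have "\<dots> = real N powr - (\<epsilon> * real l)"
        using N powr_realpow[of "real N powr - \<epsilon>" l] by (simp add: powr_powr)
      also have "\<dots> \<le> real N powr - 1" using N l1 by (intro powr_mono) auto
      also have "\<dots> = 1 / real N" using N by (simp add: powr_minus_divide)
      finally show "(H * S / V) ^ l \<le> 1 / real N" .
      show "0 \<le> (H * S / V) ^ l" using H0 S0 V0 by simp
    qed (use V0 N in auto)
    also have "\<dots> = 3 * V * real N ^ 3"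
      using N by (simp add: field_simps power2_eq_square power3_eq_cube)
    also have "\<dots> = A * (real N powr \<epsilon> * real N powr \<epsilon> * real N powr - \<beta> * real N powr 3)"
      using N by (simp add: V_def H_def Q_def A_def algebra_simps)
    also have "\<dots> = A * real N powr (3 - \<beta> + (1 - \<beta>) / 2)"
    proof -
      have "\<epsilon> + \<epsilon> + - \<beta> + 3 = 3 - \<beta> + (1 - \<beta>) / 2" by (simp add: \<epsilon>_def field_simps)
      then show ?thesis by (simp only: powr_add[symmetric])
    qed
    finally show ?thesis .
  qed
  moreover have "A \<ge> 0" using C pq by (simp add: A_def)
  ultimately show ?thesis by blast
qed

text \<open>By monotone convergence the sum of all squares has finite integral, so it converges at
  almost every point and its terms tend to zero there.\<close>

lemma AE_tendsto_zero_of_summable_square_integrals: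
  fixes g :: "nat \<Rightarrow> 'a \<Rightarrow> real"
  assumes int: "\<And>k. integrable M (\<lambda>x. (g k x)\<^sup>2)"
    and sum: "summable (\<lambda>k. \<integral>x. (g k x)\<^sup>2 \<partial>M)"
  shows "AE x in M. (\<lambda>k. g k x) \<longlonglongrightarrow> 0"
proof -
  have meas: "(\<lambda>x. ennreal ((g k x)\<^sup>2)) \<in> borel_measurable M" for k
    using borel_measurable_integrable[OF int] by (rule measurable_compose) simp
  have "(\<integral>\<^sup>+x. (\<Sum>k. ennreal ((g k x)\<^sup>2)) \<partial>M) = (\<Sum>k. \<integral>\<^sup>+x. ennreal ((g k x)\<^sup>2) \<partial>M)"
    by (rule nn_integral_suminf[OF meas])
  also have "\<dots> = (\<Sum>k. ennreal (\<integral>x. (g k x)\<^sup>2 \<partial>M))"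
    by (simp add: nn_integral_eq_integral[OF int])
  also have "\<dots> \<noteq> \<infinity>"
    unfolding infinity_ennreal_def by (rule ennreal_suminf_neq_top[OF sum]) simp
  finally have "AE x in M. (\<Sum>k. ennreal ((g k x)\<^sup>2)) \<noteq> \<infinity>"
    by (rule nn_integral_PInf_AE[OF borel_measurable_suminf_order[OF meas]])
  then show ?thesis
  proof eventually_elim
    case (elim x)
    then have "summable (\<lambda>k. (g k x)\<^sup>2)"
      by (intro summable_suminf_not_top) (auto simp: infinity_ennreal_def)
    then have "(\<lambda>k. (g k x)\<^sup>2) \<longlonglongrightarrow> 0" by (rule summable_LIMSEQ_zero)
    then have "(\<lambda>k. sqrt ((g k x)\<^sup>2)) \<longlonglongrightarrow> sqrt 0" by (rule tendsto_real_sqrt)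
    then show ?case by (simp add: tendsto_rabs_zero_iff)
  qed
qed

section \<open>Almost everywhere convergence\<close>

definition ppc_ratio :: "real \<Rightarrow> (nat \<Rightarrow> real) \<Rightarrow> real \<Rightarrow> nat \<Rightarrow> real" where
  "ppc_ratio \<beta> u s N = 1 / real N powr (2 - \<beta>) * real (pair_count \<beta> u s N)"

lemma pair_count_eq_sum:
  "real (pair_count \<beta> u s N)
     = (\<Sum>(i, j)\<in>offdiag N. of_bool (dist_nearest_int (u i - u j) \<le> s / real N powr \<beta>))"
proof -
  have "(\<Sum>(i, j)\<in>offdiag N. of_bool (dist_nearest_int (u i - u j) \<le> s / real N powr \<beta>))
      = real (card (offdiag N \<inter> {r. dist_nearest_int (u (fst r) - u (snd r)) \<le> s / real N powr \<beta>}))"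
    unfolding split_def by (subst sum_of_bool_eq) (auto simp: finite_offdiag)
  also have "offdiag N \<inter> {r. dist_nearest_int (u (fst r) - u (snd r)) \<le> s / real N powr \<beta>}
      = {(i, j). i \<in> {1..N} \<and> j \<in> {1..N} \<and> i \<noteq> j \<and> dist_nearest_int (u i - u j) \<le> s / real N powr \<beta>}"
    by (auto simp: offdiag_def)
  finally show ?thesis by (simp add: pair_count_def)
qed

text \<open>Up to \<open>1 / N\<close> the cosine polynomial lies above the indicator with threshold
  \<open>p\<close> and below the one with threshold \<open>q\<close>. Of the two terms
  \<open>N powr (\<beta> - 1)\<close> one pays for this error over all pairs, the other for the
  \<open>1 / N\<close> in the bounds on \<open>c 0\<close>; the term \<open>2 * p / N\<close> is the
  missing diagonal.\<close>

lemma ppc_ratio_sandwich: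
  fixes a :: "nat \<Rightarrow> nat" and x :: real
  assumes c: "ramp_coeffs \<beta> p q N c" and N1: "N \<ge> 1" and p: "0 < p" "p < q"
  defines "u \<equiv> \<lambda>n. real (a n) * x"
  shows "ppc_ratio \<beta> u p N \<le> 2 * q + 2 * real N powr (\<beta> - 1) + fluctuation a c N x / real N powr (2 - \<beta>)"
    and "ppc_ratio \<beta> u q N \<ge> 2 * p - 2 * p / real N - 2 * real N powr (\<beta> - 1)
            + fluctuation a c N x / real N powr (2 - \<beta>)"
proof -
  define P where "P y = (\<Sum>k\<le>N ^ 8. c k * cos (2 * pi * real k * y))" for y
  have cP: "\<And>y. dist_nearest_int y \<le> p / real N powr \<beta> \<Longrightarrow> 1 - 1 / real N \<le> P y"
     "\<And>y. q / real N powr \<beta> \<le> dist_nearest_int y \<Longrightarrow> P y \<le> 1 / real N"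
     "\<And>y. 0 \<le> P y" "\<And>y. P y \<le> 1"
     and c0: "2 * p / real N powr \<beta> - 1 / real N \<le> c 0" "c 0 \<le> 2 * q / real N powr \<beta> + 1 / real N"
    using c by (auto simp: ramp_coeffs_def P_def)
  have N: "real N \<ge> 1" "real N > 0" using N1 by auto
  define F where "F = fluctuation a c N x"
  define W where "W = real N powr (2 - \<beta>)"
  have W: "W > 0" using N by (simp add: W_def)
  have "P (u i - u j) = c 0 + (\<Sum>k\<in>{1..N ^ 8}. c k * cos (2 * pi * real k * (real (gap a (i, j)) * x)))" for i j
  proof -
    have "\<bar>u i - u j\<bar> = \<bar>real (gap a (i, j)) * x\<bar>"
      by (simp add: u_def gap_def abs_mult left_diff_distrib[symmetric])
    then have cos: "cos (2 * pi * real k * (u i - u j)) = cos (2 * pi * real k * (real (gap a (i, j)) * x))" for k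
      by (metis abs_mult cos_abs_real)
    have "{..N ^ 8} = insert 0 {1..N ^ 8}" by auto
    then show ?thesis by (simp add: P_def cos)
  qed
  then have sumP: "(\<Sum>(i, j)\<in>offdiag N. P (u i - u j)) = c 0 * ((real N)\<^sup>2 - real N) + F"
    by (simp add: F_def fluctuation_def split_def sum.distrib card_offdiag)
  have NN: "(real N)\<^sup>2 - real N \<ge> 0" "(real N)\<^sup>2 - real N \<le> (real N)\<^sup>2"
    using N by (auto simp: power2_eq_square)
  have W1: "(real N)\<^sup>2 / real N powr \<beta> = W" "real N / W = real N powr (\<beta> - 1)"
    "real N / real N powr \<beta> = W / real N"
  proof -
    have "(real N)\<^sup>2 = real N powr 2" "real N = real N powr 1" using N by auto
    then show "(real N)\<^sup>2 / real N powr \<beta> = W" "real N / W = real N powr (\<beta> - 1)"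
      "real N / real N powr \<beta> = W / real N"
      using N by (simp_all add: W_def powr_diff[symmetric] powr_diff power2_eq_square field_simps)
  qed
  show "ppc_ratio \<beta> u p N \<le> 2 * q + 2 * real N powr (\<beta> - 1) + fluctuation a c N x / real N powr (2 - \<beta>)"
  proof -
    have "real (pair_count \<beta> u p N) \<le> (\<Sum>(i, j)\<in>offdiag N. P (u i - u j) + 1 / real N)"
      unfolding pair_count_eq_sum split_def
    proof (rule sum_mono)
      fix r
      show "of_bool (dist_nearest_int (u (fst r) - u (snd r)) \<le> p / real N powr \<beta>)
          \<le> P (u (fst r) - u (snd r)) + 1 / real N"
        using cP(1)[of "u (fst r) - u (snd r)"] cP(3)[of "u (fst r) - u (snd r)"] N by (auto simp: of_bool_def)
    qed
    also have "\<dots> = (c 0 + 1 / real N) * ((real N)\<^sup>2 - real N) + F"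
      using sumP by (simp add: split_def sum.distrib card_offdiag algebra_simps diff_divide_distrib)
    also have "\<dots> \<le> (2 * q / real N powr \<beta> + 1 / real N + 1 / real N) * ((real N)\<^sup>2 - real N) + F"
      using c0 NN by (intro add_right_mono mult_right_mono) auto
    also have "\<dots> \<le> (2 * q / real N powr \<beta> + 1 / real N + 1 / real N) * (real N)\<^sup>2 + F"
      using NN p N by (intro add_right_mono mult_left_mono) auto
    also have "\<dots> = 2 * q * W + 2 * real N + F"
      unfolding W1(1)[symmetric] using N by (simp add: algebra_simps power2_eq_square)
    finally have "real (pair_count \<beta> u p N) / W \<le> (2 * q * W + 2 * real N + F) / W"
      using W by (intro divide_right_mono) auto
    also have "\<dots> = 2 * q + 2 * (real N / W) + F / W"
      using W by (simp add: add_divide_distrib)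
    finally show ?thesis by (simp add: ppc_ratio_def W1 F_def W_def[symmetric])
  qed
  show "ppc_ratio \<beta> u q N \<ge> 2 * p - 2 * p / real N - 2 * real N powr (\<beta> - 1)
            + fluctuation a c N x / real N powr (2 - \<beta>)"
  proof -
    have "2 * p * (W - W / real N) - real N = 2 * p * ((real N)\<^sup>2 / real N powr \<beta>  - real N / real N powr \<beta>) - real N"
      by (simp only: W1)
    also have "\<dots> = (2 * p / real N powr \<beta>) * ((real N)\<^sup>2 - real N) - real N"
      by (simp add: algebra_simps diff_divide_distrib)
    also have "\<dots> \<le> (2 * p / real N powr \<beta>) * ((real N)\<^sup>2 - real N) - (1 / real N) * ((real N)\<^sup>2 - real N)"
      using N by (simp add: field_simps power2_eq_square)
    also have "\<dots> = (2 * p / real N powr \<beta> - 1 / real N) * ((real N)\<^sup>2 - real N)"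
      by (simp add: left_diff_distrib)
    also have "\<dots> \<le> c 0 * ((real N)\<^sup>2 - real N)"
      using c0 NN by (intro mult_right_mono) auto
    finally have "2 * p * (W - W / real N) - real N \<le> c 0 * ((real N)\<^sup>2 - real N)" .
    moreover have "(1 / real N) * ((real N)\<^sup>2 - real N) \<le> real N"
      using N by (simp add: field_simps power2_eq_square)
    moreover have "(\<Sum>(i, j)\<in>offdiag N. P (u i - u j) - 1 / real N)
        = c 0 * ((real N)\<^sup>2 - real N) - (1 / real N) * ((real N)\<^sup>2 - real N) + F"
      using sumP by (simp add: split_def sum_subtractf card_offdiag)
    moreover have "(\<Sum>(i, j)\<in>offdiag N. P (u i - u j) - 1 / real N) \<le> real (pair_count \<beta> u q N)"
      unfolding pair_count_eq_sum split_def
    proof (rule sum_mono)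
      fix r
      have "P (u (fst r) - u (snd r)) - 1 / real N \<le> 1"
        using cP(4)[of "u (fst r) - u (snd r)"] by (simp add: add_increasing2 algebra_simps)
      then show "P (u (fst r) - u (snd r)) - 1 / real N
          \<le> of_bool (dist_nearest_int (u (fst r) - u (snd r)) \<le> q / real N powr \<beta>)"
        using cP(2)[of "u (fst r) - u (snd r)"]
        by (cases "dist_nearest_int (u (fst r) - u (snd r)) \<le> q / real N powr \<beta>") auto
    qed
    ultimately have "2 * p * (W - W / real N) - 2 * real N + F \<le> real (pair_count \<beta> u q N)" by linarith
    then have "(2 * p * (W - W / real N) - 2 * real N + F) / W \<le> real (pair_count \<beta> u q N) / W"
      using W by (intro divide_right_mono) auto
    moreover have "(2 * p * (W - W / real N) - 2 * real N + F) / W = 2 * p - 2 * p / real N - 2 * (real N / W) + F / W"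
      using W by (simp add: add_divide_distrib diff_divide_distrib right_diff_distrib)
    ultimately show ?thesis by (simp add: ppc_ratio_def W1 F_def W_def[symmetric])
  qed
qed

text \<open>The normalised variance is at most of order \<open>N powr (- (1 - \<beta>) / 2)\<close>,
  which is summable along \<open>N = (k + 1) ^ m\<close>. The exceptional null set may depend on
  \<open>p\<close> and \<open>q\<close> but not on \<open>e\<close>.\<close>

lemma AE_ppc_ratio_bounds_subsequence:
  fixes a :: "nat \<Rightarrow> nat"
  assumes inj: "inj_on a {1..}" and \<beta>: "0 < \<beta>" "\<beta> < 1" and pq: "0 < p" "p < q"
    and m: "real m * (1 - \<beta>) \<ge> 4"
  shows "AE x in lebesgue_on {0..1}. \<forall>e>0. \<forall>\<^sub>F k in sequentially.
      ppc_ratio \<beta> (\<lambda>n. real (a n) * x) p (Suc k ^ m) \<le> 2 * q + e \<and>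
      ppc_ratio \<beta> (\<lambda>n. real (a n) * x) q (Suc k ^ m) \<ge> 2 * p - e"
proof -
  have m0: "m > 0" using m by (cases m) auto
  obtain N0 where "\<And>N. N \<ge> N0 \<Longrightarrow> \<exists>c. ramp_coeffs \<beta> p q N c"
    using eventually_ramp_coeffs[OF \<beta> pq] unfolding eventually_sequentially by blast
  \<comment> \<open>Below \<open>N0\<close> the chosen coefficients are arbitrary; the comparison
    test looks only at the tail.\<close>
  then obtain c where c: "\<And>N. N \<ge> N0 \<Longrightarrow> ramp_coeffs \<beta> p q N (c N)" by metis
  obtain A where A: "A \<ge> 0" "\<And>N c. N \<ge> 1 \<Longrightarrow> ramp_coeffs \<beta> p q N c \<Longrightarrow>
     (\<integral>x. (fluctuation a c N x)\<^sup>2 \<partial>lebesgue_on {0..1}) \<le> A * real N powr (3 - \<beta> + (1 - \<beta>) / 2)"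
    using fluctuation_variance[OF inj \<beta> pq] by blast
  define \<nu> where "\<nu> k = Suc k ^ m" for k :: nat
  have \<nu>1: "\<nu> k \<ge> 1" for k by (simp add: \<nu>_def)
  have \<nu>k: "\<nu> k \<ge> k" for k
    using m0 self_le_power[of "Suc k" m] by (simp add: \<nu>_def)
  have top: "filterlim \<nu> at_top sequentially"
    using \<nu>k by (intro filterlim_at_top_mono[OF filterlim_ident]) auto
  have topr: "filterlim (\<lambda>k. real (\<nu> k)) at_top sequentially"
    by (rule filterlim_compose[OF filterlim_real_sequentially top])
  define g where "g k x = fluctuation a (c (\<nu> k)) (\<nu> k) x / real (\<nu> k) powr (2 - \<beta>)" for k x
  have "continuous_on B (fluctuation a d n)" for B d n
    unfolding fluctuation_def by (intro continuous_intros)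
  then have int: "integrable (lebesgue_on {0..1}) (\<lambda>x. (g k x)\<^sup>2)" for k
    unfolding g_def using \<nu>1[of k] by (intro integrable_continuous_unit continuous_intros) auto
  have bound: "(\<integral>x. (g k x)\<^sup>2 \<partial>lebesgue_on {0..1}) \<le> A * inverse ((real (Suc k))\<^sup>2)" if "k \<ge> N0" for k
  proof -
    have "N0 \<le> \<nu> k" using that \<nu>k[of k] by linarith
    define n where "n = real (\<nu> k)"
    have n: "n > 0" using \<nu>1[of k] by (simp add: n_def)
    have "(\<integral>x. (g k x)\<^sup>2 \<partial>lebesgue_on {0..1})
        = (\<integral>x. (fluctuation a (c (\<nu> k)) (\<nu> k) x)\<^sup>2 \<partial>lebesgue_on {0..1}) / (n powr (2 - \<beta>))\<^sup>2"
      by (simp add: g_def power_divide n_def)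
    also have "\<dots> \<le> A * n powr (3 - \<beta> + (1 - \<beta>) / 2) / (n powr (2 - \<beta>))\<^sup>2"
      unfolding n_def using A(2)[OF \<nu>1 c[OF \<open>N0 \<le> \<nu> k\<close>]] by (intro divide_right_mono) auto
    also have "(n powr (2 - \<beta>))\<^sup>2 = n powr (2 * (2 - \<beta>))"
      using n by (simp add: powr_power mult.commute)
    also have "A * n powr (3 - \<beta> + (1 - \<beta>) / 2) / n powr (2 * (2 - \<beta>)) = A * n powr (- ((1 - \<beta>) / 2))"
    proof -
      have "3 - \<beta> + (1 - \<beta>) / 2 - 2 * (2 - \<beta>) = - ((1 - \<beta>) / 2)" by (simp add: field_simps)
      then show ?thesis by (simp only: powr_diff[symmetric] times_divide_eq_right[symmetric])
    qed
    also have "n powr (- ((1 - \<beta>) / 2)) = real (Suc k) powr (- (real m * (1 - \<beta>) / 2))"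
      using powr_realpow[of "real (Suc k)" m] powr_powr[of "real (Suc k)" "real m" "- ((1 - \<beta>) / 2)"]
      by (simp add: n_def \<nu>_def)
    \<comment> \<open>Here \<open>m * (1 - \<beta>) \<ge> 4\<close> turns the small power saving
      into a summable one.\<close>
    also have "\<dots> \<le> real (Suc k) powr (- 2)"
      using m by (intro powr_mono) auto
    also have "\<dots> = inverse ((real (Suc k))\<^sup>2)"
      by (simp add: powr_minus)
    finally show ?thesis using A(1) by (simp add: mult_left_mono)
  qed
  have "summable (\<lambda>k. A * inverse ((real (Suc k))\<^sup>2))"
    using inverse_power_summable[of 2, where 'a = real]
      summable_Suc_iff[of "\<lambda>n. inverse ((real n)\<^sup>2)"]
    by (intro summable_mult) simp
  then have "summable (\<lambda>k. \<integral>x. (g k x)\<^sup>2 \<partial>lebesgue_on {0..1})"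
  proof (rule summable_comparison_test_ev[rotated])
    show "\<forall>\<^sub>F k in sequentially. norm (\<integral>x. (g k x)\<^sup>2 \<partial>lebesgue_on {0..1}) \<le> A * inverse ((real (Suc k))\<^sup>2)"
      using eventually_ge_at_top[of N0]
    proof eventually_elim
      case (elim k)
      have "(\<integral>x. (g k x)\<^sup>2 \<partial>lebesgue_on {0..1}) \<ge> 0" by (rule integral_nonneg_AE) auto
      with bound[OF elim] show ?case by simp
    qed
  qed
  from AE_tendsto_zero_of_summable_square_integrals[OF int this]
  show ?thesis
  proof eventually_elim
    case (elim x)
    have z: "(\<lambda>k. 2 * real (\<nu> k) powr (\<beta> - 1)) \<longlonglongrightarrow> 2 * 0" "(\<lambda>k. 2 * p / real (\<nu> k)) \<longlonglongrightarrow> 0"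
      using \<beta> by (auto intro!: tendsto_intros tendsto_neg_powr tendsto_divide_0[OF tendsto_const]
          filterlim_at_top_imp_at_infinity topr)
    have up: "(\<lambda>k. 2 * q + 2 * real (\<nu> k) powr (\<beta> - 1) + g k x) \<longlonglongrightarrow> 2 * q + 2 * 0 + 0"
      by (intro tendsto_add tendsto_const z elim)
    have lo: "(\<lambda>k. 2 * p - 2 * p / real (\<nu> k) - 2 * real (\<nu> k) powr (\<beta> - 1) + g k x) \<longlonglongrightarrow> 2 * p - 0 - 2 * 0 + 0"
      by (intro tendsto_add tendsto_diff tendsto_const z elim)
    show ?case
    proof (intro allI impI)
      fix e :: real assume e: "e > 0"
      have "\<forall>\<^sub>F k in sequentially. 2 * q + 2 * real (\<nu> k) powr (\<beta> - 1) + g k x < 2 * q + e"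
        using e by (intro order_tendstoD(2)[OF up]) auto
      moreover have "\<forall>\<^sub>F k in sequentially.
          2 * p - 2 * p / real (\<nu> k) - 2 * real (\<nu> k) powr (\<beta> - 1) + g k x > 2 * p - e"
        using e by (intro order_tendstoD(1)[OF lo]) auto
      moreover have "\<forall>\<^sub>F k in sequentially. k \<ge> N0" by (rule eventually_ge_at_top)
      ultimately show "\<forall>\<^sub>F k in sequentially.
          ppc_ratio \<beta> (\<lambda>n. real (a n) * x) p (Suc k ^ m) \<le> 2 * q + e \<and>
          ppc_ratio \<beta> (\<lambda>n. real (a n) * x) q (Suc k ^ m) \<ge> 2 * p - e"
      proof eventually_elim
        case (elim k)
        then have "N0 \<le> \<nu> k" using \<nu>k[of k] by linarith
        from ppc_ratio_sandwich[OF c[OF this] \<nu>1 pq, of a x] elim show ?case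
          unfolding g_def \<nu>_def by linarith
      qed
    qed
  qed
qed

section \<open>From the subsequence to all N, and from rational to real thresholds\<close>

lemma pair_count_mono:
  assumes "M \<le> N" "s / real M powr \<beta> \<le> t / real N powr \<beta>"
  shows "pair_count \<beta> u s M \<le> pair_count \<beta> u t N"
  unfolding pair_count_def
proof (rule card_mono)
  show "finite {(i, j). i \<in> {1..N} \<and> j \<in> {1..N} \<and> i \<noteq> j \<and> dist_nearest_int (u i - u j) \<le> t / real N powr \<beta>}"
    by (rule finite_subset[of _ "{1..N} \<times> {1..N}"]) auto
qed (use assms in auto)

text \<open>More points only add pairs, provided the threshold is widened by
  \<open>\<rho> powr \<beta>\<close> to offset the larger denominator \<open>N powr \<beta>\<close>;
  the normalisations differ by at most \<open>\<rho> powr (2 - \<beta>)\<close>.\<close>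

lemma ppc_ratio_le:
  assumes "1 \<le> M" "M \<le> N" "real N / real M \<le> \<rho>" "0 < \<beta>" "\<beta> < 1" "0 < s"
  shows "ppc_ratio \<beta> u s M \<le> \<rho> powr (2 - \<beta>) * ppc_ratio \<beta> u (s * \<rho> powr \<beta>) N"
proof -
  have pos: "real M > 0" "real N > 0" "\<rho> > 0" using assms by (auto intro: less_le_trans[of _ "real N / real M"])
  have le: "real N \<le> \<rho> * real M" using assms pos by (simp add: field_simps)
  have "real N powr \<beta> \<le> (\<rho> * real M) powr \<beta>"
    using le assms by (intro powr_mono2) auto
  also have "\<dots> = \<rho> powr \<beta> * real M powr \<beta>" using pos by (simp add: powr_mult)
  finally have "s * real N powr \<beta> \<le> s * (\<rho> powr \<beta> * real M powr \<beta>)"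
    using assms by (intro mult_left_mono) auto
  then have "s / real M powr \<beta> \<le> (s * \<rho> powr \<beta>) / real N powr \<beta>"
    using pos by (simp add: field_simps)
  then have "pair_count \<beta> u s M \<le> pair_count \<beta> u (s * \<rho> powr \<beta>) N"
    using assms by (intro pair_count_mono) auto
  moreover have "1 / real M powr (2 - \<beta>) \<le> \<rho> powr (2 - \<beta>) / real N powr (2 - \<beta>)"
  proof -
    have "real N powr (2 - \<beta>) \<le> (\<rho> * real M) powr (2 - \<beta>)"
      using le assms by (intro powr_mono2) auto
    also have "\<dots> = \<rho> powr (2 - \<beta>) * real M powr (2 - \<beta>)" using pos by (simp add: powr_mult)
    finally show ?thesis using pos by (simp add: field_simps)
  qed
  ultimately have "1 / real M powr (2 - \<beta>) * real (pair_count \<beta> u s M)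
      \<le> \<rho> powr (2 - \<beta>) / real N powr (2 - \<beta>) * real (pair_count \<beta> u (s * \<rho> powr \<beta>) N)"
    using pos by (intro mult_mono) auto
  then show ?thesis by (simp add: ppc_ratio_def mult.assoc)
qed

lemma ppc_ratio_mono:
  assumes "s \<le> t"
  shows "ppc_ratio \<beta> u s N \<le> ppc_ratio \<beta> u t N"
proof -
  have "pair_count \<beta> u s N \<le> pair_count \<beta> u t N"
    using assms by (intro pair_count_mono divide_right_mono) auto
  then show ?thesis unfolding ppc_ratio_def by (intro mult_left_mono) auto
qed

text \<open>The ratio is monotone in the threshold and the limit \<open>2 * s\<close> is continuous
  in it, so countably many thresholds control all real ones.\<close>

lemma ppc_ratio_tendsto_of_rational_bounds:
  assumes bounds: "\<And>(p::rat) (q::rat) e. 0 < p \<Longrightarrow> p < q \<Longrightarrow> 0 < e \<Longrightarrow>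
      \<forall>\<^sub>F k in sequentially. ppc_ratio \<beta> u (of_rat p) (\<nu> k) \<le> 2 * of_rat q + e \<and>
                             ppc_ratio \<beta> u (of_rat q) (\<nu> k) \<ge> 2 * of_rat p - e"
    and s: "0 < s"
  shows "(\<lambda>k. ppc_ratio \<beta> u s (\<nu> k)) \<longlonglongrightarrow> 2 * s"
proof (rule tendstoI)
  fix e :: real assume e: "0 < e"
  \<comment> \<open>Rationals \<open>p < q\<close> just above \<open>s\<close> serve the upper bound
    and \<open>p' < q'\<close> just below it the lower one. Twice a displacement below
    \<open>e / 4\<close> plus the error \<open>e / 4\<close> stays under \<open>e\<close>; the
    \<open>max 0\<close> keeps \<open>p'\<close> positive.\<close>
  obtain p :: rat where p: "s < of_rat p" "of_rat p < s + e / 4"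
    using of_rat_dense[of s "s + e / 4"] e by auto
  obtain q :: rat where q: "of_rat p < (of_rat q :: real)" "of_rat q < s + e / 4"
    using of_rat_dense[OF p(2)] by auto
  obtain q' :: rat where q': "max 0 (s - e / 4) < of_rat q'" "of_rat q' < s"
    using of_rat_dense[of "max 0 (s - e / 4)" s] e s by auto
  obtain p' :: rat where p': "max 0 (s - e / 4) < of_rat p'" "of_rat p' < (of_rat q' :: real)"
    using of_rat_dense[OF q'(1)] by auto
  have p0: "0 < p" "p < q" "0 < p'" "p' < q'"
  proof -
    have "(0::real) < of_rat p" "(0::real) < of_rat p'" using p(1) p'(1) s by linarith+
    then show "0 < p" "p < q" "0 < p'" "p' < q'"
      using q(1) p'(2) by (simp_all add: of_rat_less)
  qed
  have e4: "e / 4 > 0" using e by simp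
  from bounds[OF p0(1,2) e4] bounds[OF p0(3,4) e4]
  show "\<forall>\<^sub>F k in sequentially. dist (ppc_ratio \<beta> u s (\<nu> k)) (2 * s) < e"
  proof eventually_elim
    case (elim k)
    have "ppc_ratio \<beta> u s (\<nu> k) \<le> ppc_ratio \<beta> u (of_rat p) (\<nu> k)"
      "ppc_ratio \<beta> u (of_rat q') (\<nu> k) \<le> ppc_ratio \<beta> u s (\<nu> k)"
      using p q' by (auto intro: ppc_ratio_mono)
    then show ?case using elim q(2) p'(1) unfolding dist_real_def by linarith
  qed
qed

text \<open>Each \<open>N\<close> lies between consecutive terms of the subsequence, whose ratio
  tends to 1. Comparison with both neighbours loses only factors that can be made close to
  1.\<close>

lemma has_PPC_of_subsequence:
  assumes \<beta>: "0 < \<beta>" "\<beta> < 1"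
    and sub: "\<And>s. s > 0 \<Longrightarrow> (\<lambda>k. ppc_ratio \<beta> u s (Suc k ^ m)) \<longlonglongrightarrow> 2 * s"
    and m: "m > 0"
  shows "has_PPC \<beta> u"
  unfolding has_PPC_def ppc_ratio_def[symmetric]
proof (intro allI impI tendstoI)
  fix s e :: real assume s: "0 < s" and e: "0 < e"
  define \<nu> where "\<nu> k = Suc k ^ m" for k :: nat
  \<comment> \<open>\<open>\<rho>\<^sup>2\<close> is the combined loss:
    \<open>\<rho> powr (2 - \<beta>)\<close> from the normalisation and
    \<open>\<rho> powr \<beta>\<close> from the threshold.\<close>
  have "((\<lambda>\<rho>. 2 * s * \<rho>\<^sup>2) \<longlongrightarrow> 2 * s * 1\<^sup>2) (at_right 1)"
       "((\<lambda>\<rho>. 2 * s / \<rho>\<^sup>2) \<longlongrightarrow> 2 * s / 1\<^sup>2) (at_right 1)"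
    by (intro tendsto_intros; simp)+
  then have "\<forall>\<^sub>F \<rho> in at_right 1. 2 * s * \<rho>\<^sup>2 < 2 * s + e" "\<forall>\<^sub>F \<rho> in at_right 1. 2 * s / \<rho>\<^sup>2 > 2 * s - e"
    using e by (auto elim!: order_tendstoD)
  moreover have "\<forall>\<^sub>F \<rho> in at_right (1::real). \<rho> > 1" by (rule eventually_at_right_less)
  ultimately have "\<forall>\<^sub>F \<rho> in at_right 1. 2 * s * \<rho>\<^sup>2 < 2 * s + e \<and> 2 * s / \<rho>\<^sup>2 > 2 * s - e \<and> \<rho> > 1"
    by eventually_elim auto
  then obtain \<rho> where \<rho>: "2 * s * \<rho>\<^sup>2 < 2 * s + e" "2 * s / \<rho>\<^sup>2 > 2 * s - e" "\<rho> > 1"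
    using eventually_happens'[of "at_right (1::real)"] by auto
  have \<rho>2: "\<rho> powr (2 - \<beta>) * \<rho> powr \<beta> = \<rho>\<^sup>2" using \<rho> by (simp flip: powr_add)
  \<comment> \<open>Narrowed so that the widening in \<open>ppc_ratio_le\<close> gives back the
    threshold \<open>s\<close>.\<close>
  define t where "t = s / \<rho> powr \<beta>"
  have t: "t > 0" "t * \<rho> powr \<beta> = s" using s \<rho> by (auto simp: t_def)
  have sr: "s * \<rho> powr \<beta> > 0" using s \<rho> by simp
  have "(\<lambda>k. \<rho> powr (2 - \<beta>) * ppc_ratio \<beta> u (s * \<rho> powr \<beta>) (\<nu> (Suc k))) \<longlonglongrightarrow> \<rho> powr (2 - \<beta>) * (2 * (s * \<rho> powr \<beta>))"
    unfolding \<nu>_def using LIMSEQ_Suc[OF sub[OF sr]] by (intro tendsto_intros)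
  also have "\<rho> powr (2 - \<beta>) * (2 * (s * \<rho> powr \<beta>)) = 2 * s * \<rho>\<^sup>2"
    using \<rho>2 by (simp add: algebra_simps)
  finally have up: "\<forall>\<^sub>F k in sequentially. \<rho> powr (2 - \<beta>) * ppc_ratio \<beta> u (s * \<rho> powr \<beta>) (\<nu> (Suc k)) < 2 * s + e"
    using \<rho> by (auto elim: order_tendstoD)
  have "(\<lambda>k. ppc_ratio \<beta> u t (\<nu> k) / \<rho> powr (2 - \<beta>)) \<longlonglongrightarrow> 2 * t / \<rho> powr (2 - \<beta>)"
    unfolding \<nu>_def using sub[OF t(1)] \<rho> by (intro tendsto_intros) auto
  also have "2 * t / \<rho> powr (2 - \<beta>) = 2 * s / \<rho>\<^sup>2"
    unfolding \<rho>2[symmetric] t_def by (simp add: mult.commute)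
  finally have lo: "\<forall>\<^sub>F k in sequentially. ppc_ratio \<beta> u t (\<nu> k) / \<rho> powr (2 - \<beta>) > 2 * s - e"
    using \<rho> by (auto elim: order_tendstoD)
  have "(\<lambda>k. (1 + 1 / real (Suc k)) ^ m) \<longlonglongrightarrow> (1 + 0) ^ m"
    by (intro tendsto_intros LIMSEQ_Suc[OF lim_1_over_n])
  then have "\<forall>\<^sub>F k in sequentially. (1 + 1 / real (Suc k)) ^ m < \<rho>"
    using \<rho> by (auto elim: order_tendstoD)
  with up lo have "\<forall>\<^sub>F k in sequentially. \<rho> powr (2 - \<beta>) * ppc_ratio \<beta> u (s * \<rho> powr \<beta>) (\<nu> (Suc k)) < 2 * s + e
      \<and> ppc_ratio \<beta> u t (\<nu> k) / \<rho> powr (2 - \<beta>) > 2 * s - e \<and> real (\<nu> (Suc k)) / real (\<nu> k) < \<rho>"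
  proof eventually_elim
    case (elim k)
    have "real (\<nu> (Suc k)) / real (\<nu> k) = (real (Suc (Suc k)) / real (Suc k)) ^ m"
      by (simp only: \<nu>_def of_nat_power power_divide)
    also have "real (Suc (Suc k)) / real (Suc k) = 1 + 1 / real (Suc k)"
      by (simp add: field_simps)
    finally show ?case using elim by simp
  qed
  then obtain k0 where k0: "\<And>k. k \<ge> k0 \<Longrightarrow> \<rho> powr (2 - \<beta>) * ppc_ratio \<beta> u (s * \<rho> powr \<beta>) (\<nu> (Suc k)) < 2 * s + e
      \<and> ppc_ratio \<beta> u t (\<nu> k) / \<rho> powr (2 - \<beta>) > 2 * s - e \<and> real (\<nu> (Suc k)) / real (\<nu> k) < \<rho>"
    unfolding eventually_sequentially by blast
  have \<nu>1: "\<nu> k \<ge> 1" for k by (simp add: \<nu>_def)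
  have mono: "\<nu> j \<le> \<nu> k" if "j \<le> k" for j k using that by (simp add: \<nu>_def power_mono)
  have "dist (ppc_ratio \<beta> u s N) (2 * s) < e" if N: "N \<ge> \<nu> k0" for N
  proof -
    \<comment> \<open>The block index with \<open>\<nu> k \<le> N < \<nu> (Suc k)\<close>;
      \<open>N \<ge> \<nu> k0\<close> then forces \<open>k \<ge> k0\<close>.\<close>
    define k where "k = (LEAST j. N < \<nu> (Suc j))"
    have "N < \<nu> (Suc N)"
      using m self_le_power[of "Suc (Suc N)" m] by (simp add: \<nu>_def)
    then have k1: "N < \<nu> (Suc k)" unfolding k_def by (rule LeastI)
    have k2: "\<nu> k \<le> N"
    proof (cases k)
      case 0
      then have "\<nu> k \<le> \<nu> k0" by (intro mono) simp
      then show ?thesis using N by linarith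
    next
      case (Suc j)
      then have "\<not> N < \<nu> (Suc j)" using not_less_Least[of j "\<lambda>j. N < \<nu> (Suc j)"] k_def by simp
      then show ?thesis using Suc by simp
    qed
    have "k \<ge> k0"
    proof (rule ccontr)
      assume "\<not> k \<ge> k0"
      then have "\<nu> (Suc k) \<le> \<nu> k0" by (intro mono) auto
      with k1 N show False by linarith
    qed
    note K = k0[OF this]
    have N1: "N \<ge> 1" using k2 \<nu>1[of k] by linarith
    have pos: "real N > 0" "real (\<nu> k) > 0" using N1 \<nu>1[of k] by auto
    have r1: "real (\<nu> (Suc k)) / real N \<le> \<rho>"
    proof -
      have "real (\<nu> (Suc k)) / real N \<le> real (\<nu> (Suc k)) / real (\<nu> k)"
        using k2 pos by (intro divide_left_mono) auto
      with K show ?thesis by linarith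
    qed
    have r2: "real N / real (\<nu> k) \<le> \<rho>"
    proof -
      have "real N / real (\<nu> k) \<le> real (\<nu> (Suc k)) / real (\<nu> k)"
        using k1 by (intro divide_right_mono) auto
      with K show ?thesis by linarith
    qed
    have "ppc_ratio \<beta> u s N \<le> \<rho> powr (2 - \<beta>) * ppc_ratio \<beta> u (s * \<rho> powr \<beta>) (\<nu> (Suc k))"
      using k1 by (intro ppc_ratio_le N1 r1 \<beta> s) auto
    moreover have "ppc_ratio \<beta> u t (\<nu> k) \<le> \<rho> powr (2 - \<beta>) * ppc_ratio \<beta> u (t * \<rho> powr \<beta>) N"
      by (intro ppc_ratio_le \<nu>1 r2 \<beta> t k2)
    then have "ppc_ratio \<beta> u t (\<nu> k) / \<rho> powr (2 - \<beta>) \<le> ppc_ratio \<beta> u s N"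
      using \<rho> by (simp add: t(2) field_simps)
    ultimately show ?thesis using K unfolding dist_real_def by linarith
  qed
  then show "\<forall>\<^sub>F N in sequentially. dist (ppc_ratio \<beta> u s N) (2 * s) < e"
    unfolding eventually_sequentially by blast
qed

theorem theorem6:
  fixes a :: "nat \<Rightarrow> nat" and \<beta> :: real
  assumes "strict_mono_on {1..} a"
    and "\<And>n. n \<ge> 1 \<Longrightarrow> a n > 0"
    and "0 < \<beta>" and "\<beta> < 1"
  shows "AE x in lebesgue_on {0..1}. has_PPC \<beta> (\<lambda>n. real (a n) * x)"
proof -
  have inj: "inj_on a {1..}" using assms(1) by (rule strict_mono_on_imp_inj_on)
  define m where "m = nat \<lceil>4 / (1 - \<beta>)\<rceil>"
  have "real m \<ge> 4 / (1 - \<beta>)" unfolding m_def by (rule real_nat_ceiling_ge)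
  then have m: "real m * (1 - \<beta>) \<ge> 4" using assms(4) by (simp add: field_simps)
  then have m0: "m > 0" by (cases m) auto
  \<comment> \<open>Restricting to rational thresholds makes the exceptional set a countable union
    of null sets, so one null set serves every real \<open>s\<close>.\<close>
  have "AE x in lebesgue_on {0..1}. \<forall>(p::rat) (q::rat). 0 < p \<longrightarrow> p < q \<longrightarrow> (\<forall>e>0. \<forall>\<^sub>F k in sequentially.
      ppc_ratio \<beta> (\<lambda>n. real (a n) * x) (of_rat p) (Suc k ^ m) \<le> 2 * of_rat q + e \<and>
      ppc_ratio \<beta> (\<lambda>n. real (a n) * x) (of_rat q) (Suc k ^ m) \<ge> 2 * of_rat p - e)"
    unfolding AE_all_countable
  proof (intro allI)
    fix p q :: rat
    show "AE x in lebesgue_on {0..1}. 0 < p \<longrightarrow> p < q \<longrightarrow> (\<forall>e>0. \<forall>\<^sub>F k in sequentially.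
        ppc_ratio \<beta> (\<lambda>n. real (a n) * x) (of_rat p) (Suc k ^ m) \<le> 2 * of_rat q + e \<and>
        ppc_ratio \<beta> (\<lambda>n. real (a n) * x) (of_rat q) (Suc k ^ m) \<ge> 2 * of_rat p - e)"
    proof (cases "0 < p \<and> p < q")
      case True
      then have "AE x in lebesgue_on {0..1}. \<forall>e>0. \<forall>\<^sub>F k in sequentially.
        ppc_ratio \<beta> (\<lambda>n. real (a n) * x) (of_rat p) (Suc k ^ m) \<le> 2 * of_rat q + e \<and>
        ppc_ratio \<beta> (\<lambda>n. real (a n) * x) (of_rat q) (Suc k ^ m) \<ge> 2 * of_rat p - e"
        by (intro AE_ppc_ratio_bounds_subsequence inj assms m) (auto simp: of_rat_less)
      then show ?thesis by eventually_elim auto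
    qed auto
  qed
  then show ?thesis
  proof eventually_elim
    case (elim x)
    show ?case
      using elim
      by (intro has_PPC_of_subsequence[OF assms(3,4) _ m0] ppc_ratio_tendsto_of_rational_bounds) auto
  qed
qed

end
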